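(* Let $\ell\ge1$ be an integer and $a\in\mathbb C^*$. Let $V_{\ell,a}$ be the $\mathcal U_q(\hat{sl}_\infty)$-module given by the subspace of the fusion product $V(\boxed{1}_a)\otimes V(\boxed{1}_{aq^{-2}})\otimes\cdots\otimes V(\boxed{1}_{aq^{-2(\ell-1)}})$ spanned by the vectors $\boxed{i_1}_a\otimes\boxed{i_2}_{aq^{-2}}\otimes\cdots\otimes\boxed{i_\ell}_{aq^{-2(\ell-1)}}$ with $i_1<i_2<\cdots<i_\ell$. Then $V_{\ell,a}$ is isomorphic, as a $\mathcal U_q(\hat{sl}_\infty)$-module, to the extremal fundamental loop weight module $V(Y_{\ell,aq^{-\ell+1}}Y_{0,aq}^{-1})$.
   Context: Algebra. Fix $t\in\mathbb C$ such that $q=e^{t}$ is not a root of unity, and put $q^{r}=e^{tr}$ for $r\in\mathbb Q$. For $i,j\in\mathbb Z$ let $C_{ii}=2$, $C_{i,i\pm1}=-1$, $C_{ij}=0$ otherwise; $\mathfrak h=\bigoplus_{i\in\mathbb Z}\mathbb Q h_i$; $\Lambda_i\in\mathfrak h^*$ with $\Lambda_i(h_j)=\delta_{ij}$; $\alpha_i=2\Lambda_i-\Lambda_{i-1}-\Lambda_{i+1}$. The algebra $\mathcal U_q(\hat{sl}_\infty)$ is the $\mathbb C$-algebra generated by $x_{i,r}^{\pm}$ ($i,r\in\mathbb Z$), $k_h$ ($h\in\mathfrak h$), $h_{i,m}$ ($i\in\mathbb Z$, $m\in\mathbb Z\setminus\{0\}$). With $x_i^\pm(z)=\sum_{r}x_{i,r}^\pm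 z^r$, $\phi_i^\pm(z)=\sum_{m\ge0}\phi^\pm_{i,\pm m}z^{\pm m}=k_{\pm h_i}\exp(\pm(q-q^{-1})\sum_{m\ge1}h_{i,\pm m}z^{\pm m})$, $\delta(z)=\sum_{s\in\mathbb Z}z^s$, the relations are: $k_hk_{h'}=k_{h+h'}$, $k_0=1$; all $k_h$ and all coefficients of the $\phi_i^\pm(z)$ commute; $k_hx_j^\pm(z)k_{-h}=q^{\pm\alpha_j(h)}x_j^\pm(z)$; for $\epsilon\in\{+,-\}$, $(w-q^{\pm C_{ij}}z)\phi_i^{\epsilon}(z)x_j^\pm(w)=(q^{\pm C_{ij}}w-z)x_j^\pm(w)\phi_i^{\epsilon}(z)$; $[x_i^+(z),x_j^-(w)]=\frac{\delta_{ij}}{q-q^{-1}}\big(\delta(w/z)\phi_i^+(w)-\delta(z/w)\phi_i^-(z)\big)$; $(w-q^{\pm C_{ij}}z)x_i^\pm(z)x_j^\pm(w)=(q^{\pm C_{ij}}w-z)x_j^\pm(w)x_i^\pm(z)$; for $|i-j|=1$, $x_i^\pm(z_1)x_i^\pm(z_2)x_j^\pm(w)-(q+q^{-1})x_i^\pm(z_1)x_j^\pm(w)x_i^\pm(z_2)+x_j^\pm(w)x_i^\pm(z_1)x_i^\pm(z_2)+(z_1\leftrightarrow z_2)=0$; and $[x_i^\pm(z),x_j^\pm(w)]=0$ for $|i-j|\ge2$. Extremal fundamental loop weight modules. Put $\psi(z)=\frac{q-q^{-1}z}{1-z}$. Let $\mathcal T_{[1,\ell]}$ be the set of integer sequences $T=(i_1<\cdots<i_\ell)$.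 $\tilde e_iT$ is obtained by replacing the entry $i+1$ by $i$ ($0$ if $i+1\notin T$ or $i\in T$), $\tilde f_iT$ by replacing $i$ by $i+1$ ($0$ if $i\notin T$ or $i+1\in T$). For $b\in\mathbb C^*$, $V(Y_{\ell,b}Y_{0,bq^\ell}^{-1})$ is the $\mathcal U_q(\hat{sl}_\infty)$-module with basis $\{T_b\}_{T\in\mathcal T_{[1,\ell]}}$ and action ($0_b=0$; rational functions expanded in $z^{\pm1}$ for $\phi_i^\pm$): $x_i^+(z)T_b=\sum_{p}\delta_{\{i_p=i+1\}}\delta(bq^{i+\ell+1-2p}z)(\tilde e_iT)_b$; $x_i^-(z)T_b=\sum_{p}\delta_{\{i_p=i\}}\delta(bq^{i+\ell+1-2p}z)(\tilde f_iT)_b$; $\phi_i^\pm(z)T_b=\psi(bq^{i+\ell+3-2p}z)^{-1}T_b$ if $i_p=i+1$ for some $p$ and $i\notin T$; $=\psi(bq^{i+\ell+1-2p}z)T_b$ if $i_p=i$ for some $p$ and $i+1\notin T$; $=T_b$ otherwise. Vector representation: $V(\boxed{1}_a)=V(Y_{1,a}Y_{0,aq}^{-1})$ has basis $\boxed{j}_a$, $j\in\mathbb Z$, with $x_i^+(z)\boxed{j}_a=\delta_{i,j-1}\delta(aq^{j-1}z)\boxed{j-1}_a$, $x_i^-(z)\boxed{j}_a=\delta_{i,j}\delta(aq^jz)\boxed{j+1}_a$, and $\phi_i^\pm(z)\boxed{j}_a=\psi(aq^jz)\boxed{j}_a$ if $i=j$, $\psi(aq^{j+1}z)^{-1}\boxed{j}_a$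 if $i=j-1$, $\boxed{j}_a$ otherwise. Fusion product: tensor products (or subspaces) with action by the iterated Drinfeld coproduct $\Delta(x_i^+(z))=x_i^+(z)\otimes1+\phi_i^-(z)\otimes x_i^+(z)$, $\Delta(x_i^-(z))=x_i^-(z)\otimes\phi_i^+(z)+1\otimes x_i^-(z)$, $\Delta(\phi_i^\pm(z))=\phi_i^\pm(z)\otimes\phi_i^\pm(z)$, where a product of a rational function $f(z)$ and $\delta(cz)$ is understood as $f(c^{-1})\delta(cz)$ (when $f$ has no pole at $c^{-1}$). *)

theory Defs
  imports
    Complex_Main
    "HOL-Library.Poly_Mapping"
    "HOL-Computational_Algebra.Computational_Algebra"
    "HOL-Algebra.Algebra"
    "HOL-Algebra.Algebraic_Closure_Type"
begin

datatype sign = Pos | Neg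

fun sg :: "sign \<Rightarrow> int" where
  "sg Pos = 1"
| "sg Neg = - 1"

text \<open>
  An element \<open>h\<close> of \<open>\<hh> = \<Oplus>\<^sub>i \<rat> h\<^sub>i\<close> is the finitely supported function of its coordinates.
\<close>

type_synonym cartan = "int \<Rightarrow>\<^sub>0 rat"

definition coroot :: "int \<Rightarrow> cartan" where
  "coroot i = Poly_Mapping.single i 1"

definition fund_weight :: "int \<Rightarrow> cartan \<Rightarrow> rat" where
  "fund_weight i h = Poly_Mapping.lookup h i"

definition simple_root :: "int \<Rightarrow> cartan \<Rightarrow> rat" where
  "simple_root i h = 2 * fund_weight i h - fund_weight (i - 1) h - fund_weight (i + 1) h"

definition cartan_entry :: "int \<Rightarrow> int \<Rightarrow> int" where
  "cartan_entry i j = (if i = j then 2 else if \<bar>i - j\<bar> = 1 then - 1 else 0)"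

text \<open>
  \<open>XGen s i r\<close> stands for \<open>x\<^sup>s\<^bsub>i,r\<^esub>\<close>, \<open>KGen h\<close> for \<open>k\<^sub>h\<close>.  The generators \<open>h\<^bsub>i,m\<^esub>\<close> exist only for
  \<open>m \<noteq> 0\<close>: \<open>HGen s i n\<close> stands for \<open>h\<^bsub>i,m\<^esub>\<close> with \<open>m = s (n + 1)\<close>, where \<open>n\<close> is a natural number.
\<close>

datatype uq_gen = XGen sign int int | KGen cartan | HGen sign int nat

datatype 'a word = Word (letters: "'a list")

instantiation word :: (type) monoid_add
begin

definition "0 = Word []"
definition "u + v = Word (letters u @ letters v)"

instance
  by standard (auto simp: zero_word_def plus_word_def)

end

text \<open>
  Words form the free monoid, written additively because the convolution product on
  \<^typ>\<open>'a word \<Rightarrow>\<^sub>0 complex\<close> requires this.  With that product, \<open>uq_gen word \<Rightarrow>\<^sub>0 complex\<close> is the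
  free associative unital algebra on the generators.
\<close>

type_synonym uq_free = "uq_gen word \<Rightarrow>\<^sub>0 complex"

definition scal :: "complex \<Rightarrow> uq_free" where
  "scal c = Poly_Mapping.single 0 c"

definition gen :: "uq_gen \<Rightarrow> uq_free" where
  "gen g = Poly_Mapping.single (Word [g]) 1"

definition qpow :: "complex \<Rightarrow> rat \<Rightarrow> complex" where
  "qpow t r = exp (t * of_rat r)"

definition qdiff :: "complex \<Rightarrow> complex" where
  "qdiff t = qpow t 1 - qpow t (- 1)"

text \<open>Exponential of a power series without constant term (so that the sum below is complete).\<close>

definition fps_expo :: "uq_free fps \<Rightarrow> uq_free fps" where
  "fps_expo u = Abs_fps (\<lambda>m. \<Sum>n\<le>m. scal (1 / fact n) * fps_nth (u ^ n) m)"

text \<open>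
  The series \<open>\<phi>\<^sub>i\<^sup>s\<close> as a power series in \<open>z\<close> for \<open>s = Pos\<close> and in \<open>z\<^sup>-\<^sup>1\<close> for \<open>s = Neg\<close>;
  \<open>phi t s i m\<close> is the coefficient of \<open>z\<^sup>m\<close>, for an arbitrary integer \<open>m\<close>.
\<close>

definition phi_series :: "complex \<Rightarrow> sign \<Rightarrow> int \<Rightarrow> uq_free fps" where
  "phi_series t s i =
     fps_const (gen (KGen (case s of Pos \<Rightarrow> coroot i | Neg \<Rightarrow> - coroot i))) *
     fps_expo (Abs_fps (\<lambda>m. if m = 0 then 0
                            else scal (of_int (sg s) * qdiff t) * gen (HGen s i (m - 1))))"

definition phi :: "complex \<Rightarrow> sign \<Rightarrow> int \<Rightarrow> int \<Rightarrow> uq_free" where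
  "phi t s i m = (if sg s * m \<ge> 0 then fps_nth (phi_series t s i) (nat (sg s * m)) else 0)"

abbreviation xg :: "sign \<Rightarrow> int \<Rightarrow> int \<Rightarrow> uq_free" where
  "xg s i r \<equiv> gen (XGen s i r)"

definition qC :: "complex \<Rightarrow> sign \<Rightarrow> int \<Rightarrow> int \<Rightarrow> uq_free" where
  "qC t s i j = scal (qpow t (of_int (sg s * cartan_entry i j)))"

definition serre_half ::
  "complex \<Rightarrow> sign \<Rightarrow> int \<Rightarrow> int \<Rightarrow> int \<Rightarrow> int \<Rightarrow> int \<Rightarrow> uq_free" where
  "serre_half t s i j r1 r2 p =
     xg s i r1 * xg s i r2 * xg s j p
     - scal (qpow t 1 + qpow t (- 1)) * xg s i r1 * xg s j p * xg s i r2
     + xg s j p * xg s i r1 * xg s i r2"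

text \<open>
  Each relation between currents is recorded coefficientwise, as the difference of its two sides:
  \<open>r\<close> and \<open>p\<close> are the exponents of \<open>z\<close> and \<open>w\<close>, and \<open>r1\<close>, \<open>r2\<close> those of \<open>z\<^sub>1\<close>, \<open>z\<^sub>2\<close>.
\<close>

definition relations :: "complex \<Rightarrow> uq_free set" where
  "relations t =
     {gen (KGen h) * gen (KGen h') - gen (KGen (h + h')) | h h'. True}
   \<union> {gen (KGen 0) - 1}
   \<union> {gen (KGen h) * phi t s i m - phi t s i m * gen (KGen h) | h s i m. True}
   \<union> {phi t s i m * phi t s' j n - phi t s' j n * phi t s i m | s i m s' j n. True}
   \<union> {gen (KGen h) * xg s j r * gen (KGen (- h))
        - scal (qpow t (of_int (sg s) * simple_root j h)) * xg s j r | h s j r. True}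
   \<union> {(phi t e i r * xg s j (p - 1) - qC t s i j * phi t e i (r - 1) * xg s j p)
        - (qC t s i j * xg s j (p - 1) * phi t e i r - xg s j p * phi t e i (r - 1))
       | e s i j r p. True}
   \<union> {(xg Pos i r * xg Neg j p - xg Neg j p * xg Pos i r)
        - (if i = j then scal (1 / qdiff t) * (phi t Pos i (r + p) - phi t Neg i (r + p)) else 0)
       | i j r p. True}
   \<union> {(xg s i r * xg s j (p - 1) - qC t s i j * xg s i (r - 1) * xg s j p)
        - (qC t s i j * xg s j (p - 1) * xg s i r - xg s j p * xg s i (r - 1)) | s i j r p. True}
   \<union> {serre_half t s i j r1 r2 p + serre_half t s i j r2 r1 p
       | s i j r1 r2 p. \<bar>i - j\<bar> = 1}
   \<union> {xg s i r * xg s j p - xg s j p * xg s i r | s i j r p. \<bar>i - j\<bar> \<ge> 2}"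

definition rel_ideal :: "complex \<Rightarrow> uq_free set" where
  "rel_ideal t = genideal ring_of_type_algebra (relations t)"

definition Uq :: "complex \<Rightarrow> uq_free set ring" where
  "Uq t = ring_of_type_algebra Quot rel_ideal t"

definition uq_class :: "complex \<Rightarrow> uq_free \<Rightarrow> uq_free set" where
  "uq_class t u = rel_ideal t +>\<^bsub>ring_of_type_algebra\<^esub> u"

text \<open>\<open>'b \<Rightarrow>\<^sub>0 complex\<close> is the complex vector space with basis \<open>'b\<close>.\<close>

definition vscale :: "complex \<Rightarrow> ('b \<Rightarrow>\<^sub>0 complex) \<Rightarrow> ('b \<Rightarrow>\<^sub>0 complex)" where
  "vscale c = Poly_Mapping.map (\<lambda>y. c * y)"

definition bvec :: "'b \<Rightarrow> ('b \<Rightarrow>\<^sub>0 complex)" where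
  "bvec b = Poly_Mapping.single b 1"

lemma lookup_vscale [simp]: "Poly_Mapping.lookup (vscale c v) b = c * Poly_Mapping.lookup v b"
  by (simp add: vscale_def Poly_Mapping.map.rep_eq when_def)

interpretation vs: vector_space "vscale :: complex \<Rightarrow> ('b \<Rightarrow>\<^sub>0 complex) \<Rightarrow> _"
  by unfold_locales (auto intro!: poly_mapping_eqI simp: lookup_add algebra_simps)

text \<open>
  Left unital modules over the complex algebra \<open>Uq t\<close> with underlying space \<open>V\<close>.  The action is a
  total function in HOL, but only its values on \<open>carrier (Uq t)\<close> and \<open>V\<close> are meaningful.
\<close>

definition uq_module ::
  "complex \<Rightarrow> ('b \<Rightarrow>\<^sub>0 complex) set \<Rightarrow> (uq_free set \<Rightarrow> ('b \<Rightarrow>\<^sub>0 complex) \<Rightarrow> ('b \<Rightarrow>\<^sub>0 complex)) \<Rightarrow> bool"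
where
  "uq_module t V act \<longleftrightarrow>
     vs.subspace V \<and>
     (\<forall>u\<in>carrier (Uq t). \<forall>v\<in>V. act u v \<in> V) \<and>
     (\<forall>u\<in>carrier (Uq t). \<forall>v\<in>V. \<forall>w\<in>V. act u (v + w) = act u v + act u w) \<and>
     (\<forall>u\<in>carrier (Uq t). \<forall>u'\<in>carrier (Uq t). \<forall>v\<in>V. act (u \<oplus>\<^bsub>Uq t\<^esub> u') v = act u v + act u' v) \<and>
     (\<forall>u\<in>carrier (Uq t). \<forall>u'\<in>carrier (Uq t). \<forall>v\<in>V. act (u \<otimes>\<^bsub>Uq t\<^esub> u') v = act u (act u' v)) \<and>
     (\<forall>v\<in>V. act \<one>\<^bsub>Uq t\<^esub> v = v) \<and>
     (\<forall>c. \<forall>v\<in>V. act (uq_class t (scal c)) v = vscale c v)"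

definition uq_isomorphic ::
  "complex \<Rightarrow> ('b \<Rightarrow>\<^sub>0 complex) set \<Rightarrow> (uq_free set \<Rightarrow> ('b \<Rightarrow>\<^sub>0 complex) \<Rightarrow> ('b \<Rightarrow>\<^sub>0 complex)) \<Rightarrow>
   ('c \<Rightarrow>\<^sub>0 complex) set \<Rightarrow> (uq_free set \<Rightarrow> ('c \<Rightarrow>\<^sub>0 complex) \<Rightarrow> ('c \<Rightarrow>\<^sub>0 complex)) \<Rightarrow> bool"
where
  "uq_isomorphic t V act W act' \<longleftrightarrow>
     (\<exists>f. bij_betw f V W \<and>
          (\<forall>v\<in>V. \<forall>w\<in>V. f (v + w) = f v + f w) \<and>
          (\<forall>c. \<forall>v\<in>V. f (vscale c v) = vscale c (f v)) \<and>
          (\<forall>u\<in>carrier (Uq t). \<forall>v\<in>V. f (act u v) = act' u (f v)))"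

type_synonym ratfun = "complex poly fract"

definition regular_at :: "ratfun \<Rightarrow> complex \<Rightarrow> bool" where
  "regular_at f y \<longleftrightarrow> (\<exists>n d. f = Fract n d \<and> poly d y \<noteq> 0)"

definition value_at :: "ratfun \<Rightarrow> complex \<Rightarrow> complex" where
  "value_at f y = (THE v. \<exists>n d. f = Fract n d \<and> poly d y \<noteq> 0 \<and> v = poly n y / poly d y)"

text \<open>
  \<open>expansion s f e\<close>: the formal series \<open>\<Sum>\<^sub>k e k z\<^sup>k\<close> is the expansion of \<open>f = n / d\<close> in powers of
  \<open>z\<close> (\<open>s = Pos\<close>) or of \<open>z\<^sup>-\<^sup>1\<close> (\<open>s = Neg\<close>), i.e. it has no other powers and \<open>d e = n\<close>.
\<close>

definition expansion :: "sign \<Rightarrow> ratfun \<Rightarrow> (int \<Rightarrow> complex) \<Rightarrow> bool" where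
  "expansion s f e \<longleftrightarrow>
     (\<forall>k. sg s * k < 0 \<longrightarrow> e k = 0) \<and>
     (\<exists>n d. d \<noteq> 0 \<and> f = Fract n d \<and>
        (\<forall>k. (\<Sum>j\<le>Polynomial.degree d. Polynomial.coeff d j * e (k - int j)) = (if k \<ge> 0 then Polynomial.coeff n (nat k) else 0)))"

text \<open>\<open>psi t c\<close> is the rational function \<open>\<psi>(c z)\<close> of \<open>z\<close>.\<close>

definition psi :: "complex \<Rightarrow> complex \<Rightarrow> ratfun" where
  "psi t c = Fract [:qpow t 1, - (qpow t (- 1) * c):] [:1, - c:]"

text \<open>
  A list of triples \<open>(f, c, b)\<close> denotes the current \<open>\<Sum> f(z) \<delta>(c z) b\<close> with values in the span of
  basis vectors \<open>b\<close>.  Its coefficients are formed by reading \<open>f(z) \<delta>(c z)\<close> as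
  \<open>f(c\<^sup>-\<^sup>1) \<delta>(c z)\<close>, which is legitimate when the current is regular.
\<close>

type_synonym 'b current = "(ratfun \<times> complex \<times> 'b) list"

definition current_regular :: "'b current \<Rightarrow> bool" where
  "current_regular xs \<longleftrightarrow> (\<forall>(f, c, b)\<in>set xs. c \<noteq> 0 \<and> regular_at f (inverse c))"

definition current_coeff :: "'b current \<Rightarrow> int \<Rightarrow> ('b \<Rightarrow>\<^sub>0 complex)" where
  "current_coeff xs r =
     (\<Sum>(f, c, b)\<leftarrow>xs. vscale (value_at f (inverse c) * c powi r) (bvec b))"

text \<open>
  \<open>module_with_action t B xc ph kk act\<close>: \<open>act\<close> is a module structure on the span of the basis
  vectors in \<open>B\<close>, and on \<open>b \<in> B\<close> the series \<open>x\<^sub>i\<^sup>s(z)\<close> acts by the current \<open>xc s i b\<close>, the series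
  \<open>\<phi>\<^sub>i\<^sup>s(z)\<close> by the expansion of the rational function \<open>ph i b\<close>, and \<open>k\<^sub>h\<close> by the scalar \<open>kk h b\<close>.
  The action of the \<open>h\<^bsub>i,m\<^esub>\<close> is determined by that of the \<open>\<phi>\<^sub>i\<^sup>s(z)\<close>.
\<close>

definition module_with_action ::
  "complex \<Rightarrow> 'b set \<Rightarrow> (sign \<Rightarrow> int \<Rightarrow> 'b \<Rightarrow> 'b current) \<Rightarrow> (int \<Rightarrow> 'b \<Rightarrow> ratfun) \<Rightarrow>
   (cartan \<Rightarrow> 'b \<Rightarrow> complex) \<Rightarrow> (uq_free set \<Rightarrow> ('b \<Rightarrow>\<^sub>0 complex) \<Rightarrow> ('b \<Rightarrow>\<^sub>0 complex)) \<Rightarrow> bool"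
where
  "module_with_action t B xc ph kk act \<longleftrightarrow>
     uq_module t (vs.span (bvec ` B)) act \<and>
     (\<forall>b\<in>B. \<forall>s i.
        current_regular (xc s i b) \<and>
        (\<forall>r. act (uq_class t (xg s i r)) (bvec b) = current_coeff (xc s i b) r) \<and>
        (\<exists>e. expansion s (ph i b) e \<and>
             (\<forall>m. act (uq_class t (phi t s i m)) (bvec b) = vscale (e m) (bvec b)))) \<and>
     (\<forall>b\<in>B. \<forall>h. act (uq_class t (gen (KGen h))) (bvec b) = vscale (kk h b) (bvec b))"

fun box_x :: "complex \<Rightarrow> complex \<Rightarrow> sign \<Rightarrow> int \<Rightarrow> int \<Rightarrow> int current" where
  "box_x t a Pos i j = (if i = j - 1 then [(1, a * qpow t (of_int (j - 1)), j - 1)] else [])"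
| "box_x t a Neg i j = (if i = j then [(1, a * qpow t (of_int j), j + 1)] else [])"

definition box_phi :: "complex \<Rightarrow> complex \<Rightarrow> int \<Rightarrow> int \<Rightarrow> ratfun" where
  "box_phi t a i j =
     (if i = j then psi t (a * qpow t (of_int j))
      else if i = j - 1 then inverse (psi t (a * qpow t (of_int (j + 1))))
      else 1)"

text \<open>The basis vector \<open>j\<close> has weight \<open>\<Lambda>\<^sub>j - \<Lambda>\<^bsub>j-1\<^esub>\<close>, and \<open>k\<^sub>h\<close> acts by \<open>q\<close> to the weight.\<close>

definition box_weight :: "int \<Rightarrow> cartan \<Rightarrow> rat" where
  "box_weight j h = fund_weight j h - fund_weight (j - 1) h"

definition box_k :: "complex \<Rightarrow> cartan \<Rightarrow> int \<Rightarrow> complex" where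
  "box_k t h j = qpow t (box_weight j h)"

text \<open>
  Action of the iterated Drinfeld coproduct on a pure tensor of basis vectors \<open>j\<close> (second list) of
  vector representations with spectral parameters \<open>a\<close> (first list); a pure tensor is represented by
  the list of its factors.
\<close>

fun fusion_phi :: "complex \<Rightarrow> complex list \<Rightarrow> int \<Rightarrow> int list \<Rightarrow> ratfun" where
  "fusion_phi t (a # as) i (j # js) = box_phi t a i j * fusion_phi t as i js"
| "fusion_phi t _ i _ = 1"

fun fusion_k :: "complex \<Rightarrow> cartan \<Rightarrow> int list \<Rightarrow> complex" where
  "fusion_k t h (j # js) = box_k t h j * fusion_k t h js"
| "fusion_k t h [] = 1"

fun fusion_x :: "complex \<Rightarrow> complex list \<Rightarrow> sign \<Rightarrow> int \<Rightarrow> int list \<Rightarrow> int list current" where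
  "fusion_x t (a # as) Pos i (j # js) =
     map (\<lambda>(f, c, j'). (f, c, j' # js)) (box_x t a Pos i j) @
     map (\<lambda>(f, c, js'). (box_phi t a i j * f, c, j # js')) (fusion_x t as Pos i js)"
| "fusion_x t (a # as) Neg i (j # js) =
     map (\<lambda>(f, c, j'). (f * fusion_phi t as i js, c, j' # js)) (box_x t a Neg i j) @
     map (\<lambda>(f, c, js'). (f, c, j # js')) (fusion_x t as Neg i js)"
| "fusion_x t _ _ i _ = []"

definition tableaux :: "nat \<Rightarrow> int list set" where
  "tableaux l = {T. length T = l \<and> sorted_wrt (<) T}"

definition fusion_params :: "complex \<Rightarrow> nat \<Rightarrow> complex \<Rightarrow> complex list" where
  "fusion_params t l a = map (\<lambda>s. a * qpow t (- 2 * of_nat s)) [0..<l]"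

definition fusion_space :: "nat \<Rightarrow> (int list \<Rightarrow>\<^sub>0 complex) set" where
  "fusion_space l = vs.span (bvec ` tableaux l)"

definition is_fusion_module ::
  "complex \<Rightarrow> nat \<Rightarrow> complex \<Rightarrow>
   (uq_free set \<Rightarrow> (int list \<Rightarrow>\<^sub>0 complex) \<Rightarrow> (int list \<Rightarrow>\<^sub>0 complex)) \<Rightarrow> bool"
where
  "is_fusion_module t l a act \<longleftrightarrow>
     module_with_action t (tableaux l) (fusion_x t (fusion_params t l a))
       (fusion_phi t (fusion_params t l a)) (fusion_k t) act"

definition e_tab :: "int \<Rightarrow> int list \<Rightarrow> int list option" where
  "e_tab i T = (if i + 1 \<in> set T \<and> i \<notin> set T
                then Some (map (\<lambda>j. if j = i + 1 then i else j) T) else None)"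

definition f_tab :: "int \<Rightarrow> int list \<Rightarrow> int list option" where
  "f_tab i T = (if i \<in> set T \<and> i + 1 \<notin> set T
                then Some (map (\<lambda>j. if j = i then i + 1 else j) T) else None)"

text \<open>The entries of \<open>T\<close> are \<open>i\<^sub>1, \<dots>, i\<^sub>l\<close>, whereas list indices start from \<open>0\<close>.\<close>

definition entry :: "int list \<Rightarrow> nat \<Rightarrow> int" where
  "entry T p = T ! (p - 1)"

definition position :: "int list \<Rightarrow> int \<Rightarrow> nat" where
  "position T j = (THE p. p \<in> {1..length T} \<and> entry T p = j)"

fun ext_x :: "complex \<Rightarrow> nat \<Rightarrow> complex \<Rightarrow> sign \<Rightarrow> int \<Rightarrow> int list \<Rightarrow> int list current" where
  "ext_x t l b Pos i T =
     (case e_tab i T of None \<Rightarrow> []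
      | Some T' \<Rightarrow> [(1, b * qpow t (of_int (i + int l + 1 - 2 * int p)), T').
                    p \<leftarrow> [1..<l + 1], entry T p = i + 1])"
| "ext_x t l b Neg i T =
     (case f_tab i T of None \<Rightarrow> []
      | Some T' \<Rightarrow> [(1, b * qpow t (of_int (i + int l + 1 - 2 * int p)), T').
                    p \<leftarrow> [1..<l + 1], entry T p = i])"

definition ext_phi :: "complex \<Rightarrow> nat \<Rightarrow> complex \<Rightarrow> int \<Rightarrow> int list \<Rightarrow> ratfun" where
  "ext_phi t l b i T =
     (if i + 1 \<in> set T \<and> i \<notin> set T then
        inverse (psi t (b * qpow t (of_int (i + int l + 3 - 2 * int (position T (i + 1))))))
      else if i \<in> set T \<and> i + 1 \<notin> set T then
        psi t (b * qpow t (of_int (i + int l + 1 - 2 * int (position T i))))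
      else 1)"

text \<open>
  The weight of \<open>T\<close> is the sum of the weights of its entries, so that \<open>(1 < \<dots> < l)\<close> has weight
  \<open>\<Lambda>\<^sub>l - \<Lambda>\<^sub>0\<close>; this fixes the action of \<open>k\<^sub>h\<close> also for \<open>h\<close> outside the coroot lattice.
\<close>

definition ext_k :: "complex \<Rightarrow> cartan \<Rightarrow> int list \<Rightarrow> complex" where
  "ext_k t h T = qpow t (\<Sum>j\<in>set T. box_weight j h)"

definition ext_space :: "nat \<Rightarrow> (int list \<Rightarrow>\<^sub>0 complex) set" where
  "ext_space l = vs.span (bvec ` tableaux l)"

text \<open>The module \<open>V(Y\<^bsub>l,b\<^esub> Y\<^bsub>0,bq^l\<^esub>\<^sup>-\<^sup>1)\<close>.\<close>

definition is_extremal_module ::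
  "complex \<Rightarrow> nat \<Rightarrow> complex \<Rightarrow>
   (uq_free set \<Rightarrow> (int list \<Rightarrow>\<^sub>0 complex) \<Rightarrow> (int list \<Rightarrow>\<^sub>0 complex)) \<Rightarrow> bool"
where
  "is_extremal_module t l b act \<longleftrightarrow>
     module_with_action t (tableaux l) (ext_x t l b) (ext_phi t l b) (ext_k t) act"

end

theory Submission
  imports Defs
begin

text \<open>
  For both modules \<open>x\<^sub>i\<^sup>\<plusminus>(z)\<close> maps a column \<open>T\<close> either to \<open>0\<close> or to a multiple of the column obtained
  by exchanging the values \<open>i\<close> and \<open>i + 1\<close>, with spectral parameter \<open>a q\<^bsup>i + 2 - 2p\<^esup>\<close>, where \<open>p\<close> is the
  number of entries at most \<open>i + 1\<close>. In the fusion product an unwanted summand would produce a column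
  with a repeated entry; it carries the factor \<open>\<psi>\<close> evaluated at its zero \<open>q\<^sup>2\<close>, or \<open>\<psi>\<^sup>-\<^sup>1\<close> evaluated at
  its zero \<open>1\<close>. When \<open>i\<close> and \<open>i + 1\<close> both occur in \<open>T\<close>, the two factors of the eigenvalue of
  \<open>\<phi>\<^sub>i\<^sup>\<plusminus>(z)\<close> cancel. Hence both modules have the same structure constants on the same basis, and the
  identity is an isomorphism: the \<open>h\<^bsub>i,m\<^esub>\<close> act in the same way because they can be recovered
  recursively from the \<open>\<phi>\<^sub>i\<^sup>\<plusminus>(z)\<close>.
\<close>

section \<open>Representations of the free algebra and its quotients\<close>

lemma vscale_simps [simp]:
  "vscale c (0 :: 'b \<Rightarrow>\<^sub>0 complex) = 0" "vscale 0 (v :: 'b \<Rightarrow>\<^sub>0 complex) = 0"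
  "vscale c (vscale d (v :: 'b \<Rightarrow>\<^sub>0 complex)) = vscale (c * d) v"
  by (auto intro!: poly_mapping_eqI)

lemma vscale_add: "vscale c (v + w) = vscale c v + vscale c w"
  by (rule vs.scale_right_distrib)

lemma vscale_bvec: "vscale c (bvec b) = Poly_Mapping.single b c"
  by (intro poly_mapping_eqI) (auto simp: bvec_def lookup_single when_def)

lemma vscale_conv_mult: "vscale c p = scal c * p"
  by (simp add: vscale_def scal_def mult_map_scale_conv_mult)

lemma poly_mapping_single_induct [case_names single add]:
  fixes p :: "'b \<Rightarrow>\<^sub>0 'c::comm_monoid_add"
  assumes single: "\<And>b c. P (Poly_Mapping.single b c)"
    and add: "\<And>p q. P p \<Longrightarrow> P q \<Longrightarrow> P (p + q)"
  shows "P p"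
proof -
  have "P (\<Sum>b\<in>A. Poly_Mapping.single b (Poly_Mapping.lookup p b))" if "finite A" for A
    using that
  proof (induction A rule: finite_induct)
    case empty
    then show ?case using single[of undefined 0] by simp
  qed (simp add: single add)
  moreover have "p = (\<Sum>b\<in>Poly_Mapping.keys p. Poly_Mapping.single b (Poly_Mapping.lookup p b))"
    by (intro poly_mapping_eqI) (auto simp: lookup_sum lookup_single when_def in_keys_iff)
  ultimately show ?thesis
    by (metis finite_keys)
qed

section \<open>Linear maps given on a basis\<close>

definition lin :: "('b \<Rightarrow> ('c \<Rightarrow>\<^sub>0 complex)) \<Rightarrow> ('b \<Rightarrow>\<^sub>0 complex) \<Rightarrow> ('c \<Rightarrow>\<^sub>0 complex)" where
  "lin f v = (\<Sum>b\<in>Poly_Mapping.keys v. vscale (Poly_Mapping.lookup v b) (f b))"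

lemma lin_superset:
  assumes "finite A" "Poly_Mapping.keys v \<subseteq> A"
  shows "lin f v = (\<Sum>b\<in>A. vscale (Poly_Mapping.lookup v b) (f b))"
  unfolding lin_def using assms by (intro sum.mono_neutral_left) (auto simp: in_keys_iff)

lemma lin_add: "lin f (v + w) = lin f v + lin f w"
proof -
  let ?A = "Poly_Mapping.keys v \<union> Poly_Mapping.keys w"
  have "lin f u = (\<Sum>b\<in>?A. vscale (Poly_Mapping.lookup u b) (f b))" if "u \<in> {v, w, v + w}" for u
    using that keys_add[of v w] by (intro lin_superset) auto
  then show ?thesis
    by (simp add: lookup_add vs.scale_left_distrib sum.distrib)
qed

lemma lin_single [simp]: "lin f (Poly_Mapping.single b c) = vscale c (f b)"
  by (subst lin_superset[of "{b}"]) auto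

lemma lin_bvec [simp]: "lin f (bvec b) = f b"
  by (simp add: bvec_def)

lemma lin_zero [simp]: "lin f 0 = 0"
  by (simp add: lin_def)

lemma vscale_single [simp]: "vscale c (Poly_Mapping.single b d) = Poly_Mapping.single b (c * d)"
  by (intro poly_mapping_eqI) (auto simp: lookup_single when_def)

lemma lin_vscale: "lin f (vscale c v) = vscale c (lin f v)"
  by (induction v rule: poly_mapping_single_induct) (auto simp: lin_add vscale_add)

lemma lin_fun_add: "lin (\<lambda>b. f b + g b) v = lin f v + lin g v"
  by (simp add: lin_def vscale_add sum.distrib)

lemma lin_fun_vscale: "lin (\<lambda>b. vscale c (f b)) v = vscale c (lin f v)"
  by (induction v rule: poly_mapping_single_induct) (auto simp: lin_add vscale_add mult_ac)

text \<open>\<open>foldr\<close> lets the last letter of a word act first, so concatenation of words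
  becomes composition of operators.\<close>

definition rep ::
  "('g \<Rightarrow> 'b \<Rightarrow> ('b \<Rightarrow>\<^sub>0 complex)) \<Rightarrow> ('g word \<Rightarrow>\<^sub>0 complex) \<Rightarrow> ('b \<Rightarrow>\<^sub>0 complex) \<Rightarrow> ('b \<Rightarrow>\<^sub>0 complex)"
where
  "rep G p v = lin (\<lambda>w. foldr (\<lambda>g. lin (G g)) (letters w) v) p"

lemma foldr_lin_add:
  "foldr (\<lambda>g. lin (G g)) gs (v + w) = foldr (\<lambda>g. lin (G g)) gs v + foldr (\<lambda>g. lin (G g)) gs w"
  by (induction gs) (auto simp: lin_add)

lemma foldr_lin_vscale:
  "foldr (\<lambda>g. lin (G g)) gs (vscale c v) = vscale c (foldr (\<lambda>g. lin (G g)) gs v)"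
  by (induction gs) (auto simp: lin_vscale)

lemma rep_add_left: "rep G (p + p') v = rep G p v + rep G p' v"
  by (simp add: rep_def lin_add)

lemma rep_add_right: "rep G p (v + w) = rep G p v + rep G p w"
  by (simp add: rep_def foldr_lin_add lin_fun_add)

lemma rep_vscale_right: "rep G p (vscale c v) = vscale c (rep G p v)"
  by (simp add: rep_def foldr_lin_vscale lin_fun_vscale)

lemma rep_zero_left [simp]: "rep G 0 v = 0"
  by (simp add: rep_def)

lemma rep_zero_right [simp]: "rep G p 0 = 0"
  using rep_vscale_right[of G p 0 0] by simp

lemma rep_diff_left: "rep G (p - p') v = rep G p v - rep G p' v"
  using rep_add_left[of G "p - p'" p' v] by (simp add: algebra_simps)

lemma rep_mult: "rep G (p * p') v = rep G p (rep G p' v)"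
proof (induction p rule: poly_mapping_single_induct)
  case (single w c)
  show ?case
    by (induction p' rule: poly_mapping_single_induct)
       (auto simp: rep_add_right distrib_left rep_add_left,
        simp add: rep_def mult_single plus_word_def foldr_lin_vscale)
qed (simp add: distrib_right rep_add_left)

lemma rep_scal [simp]: "rep G (scal c) v = vscale c v"
  by (simp add: rep_def scal_def zero_word_def)

lemma rep_one [simp]: "rep G (1 :: uq_free) v = v"
  using rep_scal[of G 1 v] by (simp add: scal_def)

lemma rep_gen: "rep G (gen g) v = lin (G g) v"
  by (simp add: rep_def gen_def)

lemma rep_in_subspace:
  assumes V: "vs.subspace V" and G: "\<And>g v. v \<in> V \<Longrightarrow> lin (G g) v \<in> V" and v: "v \<in> V"
  shows "rep G p v \<in> V"
proof (induction p rule: poly_mapping_single_induct)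
  case (single w c)
  have "foldr (\<lambda>g. lin (G g)) gs v \<in> V" for gs
    using v by (induction gs) (auto simp: G)
  then show ?case
    using V by (simp add: rep_def vs.subspace_scale)
qed (use V in \<open>simp add: rep_add_left vs.subspace_add\<close>)

lemma lin_span:
  assumes "\<And>b. b \<in> B \<Longrightarrow> f b \<in> V" "vs.subspace V" "v \<in> vs.span (bvec ` B)"
  shows "lin f v \<in> V"
  using assms(3)
proof (induction rule: vs.span_induct_alt)
  case base
  then show ?case using assms(2) by (simp add: vs.subspace_0)
next
  case (step c x y)
  then show ?case using assms
    by (auto simp: lin_add lin_vscale vs.subspace_add vs.subspace_scale)
qed

section \<open>The quotient by the ideal of relations\<close>

abbreviation uq_ring :: "uq_free ring" where
  "uq_ring \<equiv> ring_of_type_algebra"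

lemma uq_ring_simps [simp]:
  "carrier uq_ring = UNIV" "x \<oplus>\<^bsub>uq_ring\<^esub> y = x + y" "x \<otimes>\<^bsub>uq_ring\<^esub> y = x * y"
  "\<zero>\<^bsub>uq_ring\<^esub> = 0" "\<one>\<^bsub>uq_ring\<^esub> = 1"
  by (auto simp: ring_of_type_algebra_def)

interpretation uq_ring: ring uq_ring
proof (rule ringI)
  show "abelian_group uq_ring"
    by (rule abelian_groupI) (auto simp: add_ac intro: exI[of _ "- x" for x])
  show "monoid uq_ring"
    by (rule monoidI) (auto simp: mult_ac mult.assoc)
qed (auto simp: distrib_left distrib_right)

lemma rel_ideal: "ideal (rel_ideal t) uq_ring"
  unfolding rel_ideal_def by (rule uq_ring.genideal_ideal) auto

lemma rel_abelian_subgroup: "abelian_subgroup (rel_ideal t) uq_ring"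
proof -
  interpret ideal "rel_ideal t" uq_ring by (rule rel_ideal)
  show ?thesis by unfold_locales
qed

lemma carrier_Uq: "carrier (Uq t) = range (uq_class t)"
  by (auto simp: Uq_def FactRing_def A_RCOSETS_def' uq_class_def)

lemma uq_class_add: "uq_class t p \<oplus>\<^bsub>Uq t\<^esub> uq_class t p' = uq_class t (p + p')"
  using ring_hom_add[OF ideal.rcos_ring_hom[OF rel_ideal], of p p' t] by (simp add: uq_class_def Uq_def)

lemma uq_class_mult: "uq_class t p \<otimes>\<^bsub>Uq t\<^esub> uq_class t p' = uq_class t (p * p')"
  using ring_hom_mult[OF ideal.rcos_ring_hom[OF rel_ideal], of p p' t] by (simp add: uq_class_def Uq_def)

lemma uq_class_one: "\<one>\<^bsub>Uq t\<^esub> = uq_class t 1"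
  using ring_hom_one[OF ideal.rcos_ring_hom[OF rel_ideal], of t] by (simp add: uq_class_def Uq_def)

lemma uq_class_eqD:
  assumes "uq_class t p = uq_class t p'"
  shows "p - p' \<in> rel_ideal t"
proof -
  have "p \<in> uq_class t p'"
    using assms abelian_subgroup.a_rcos_self[OF rel_abelian_subgroup, of p t] by (simp add: uq_class_def)
  then obtain h where "h \<in> rel_ideal t" "p = h + p'"
    by (auto simp: uq_class_def a_r_coset_def')
  then show ?thesis by simp
qed

lemma uq_class_eqI:
  assumes "p - p' \<in> rel_ideal t"
  shows "uq_class t p = uq_class t p'"
proof -
  have "p \<in> uq_class t p'"
    using assms by (force simp: uq_class_def a_r_coset_def')
  then show ?thesis
    unfolding uq_class_def using abelian_subgroup.a_repr_independence'[OF rel_abelian_subgroup, of p t p'] by simp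
qed

lemma relations_subset_rel_ideal: "relations t \<subseteq> rel_ideal t"
  unfolding rel_ideal_def by (rule uq_ring.genideal_self) simp

text \<open>The elements of the free algebra that act by zero form a two-sided ideal. By linearity
  it contains the relations once they annihilate every basis vector, and then also the ideal they
  generate.\<close>

lemma rep_rel_ideal:
  assumes rel: "\<And>p b. p \<in> relations t \<Longrightarrow> rep G p (bvec b) = 0"
    and p: "p \<in> rel_ideal t"
  shows "rep G p v = 0"
proof -
  let ?K = "{p. \<forall>v. rep G p v = 0}"
  have "relations t \<subseteq> ?K"
  proof clarify
    fix p v assume "p \<in> relations t"
    then show "rep G p v = 0"
      using rel[of p] by (induction v rule: poly_mapping_single_induct)
        (auto simp: rep_add_right vscale_bvec[symmetric] rep_vscale_right)
  qed
  moreover have "ideal ?K uq_ring"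
  proof (rule idealI)
    show "subgroup ?K (add_monoid uq_ring)"
    proof (rule uq_ring.add.subgroupI)
      fix p assume p: "p \<in> ?K"
      have "\<ominus>\<^bsub>uq_ring\<^esub> p = - p"
        using uq_ring.minus_equality[of "- p" p] by simp
      then show "\<ominus>\<^bsub>uq_ring\<^esub> p \<in> ?K"
        using p rep_diff_left[of G 0 p] by simp
    qed (auto simp: rep_add_left intro: exI[of _ 0])
  qed (simp_all add: rep_mult uq_ring.ring_axioms)
  ultimately have "rel_ideal t \<subseteq> ?K"
    unfolding rel_ideal_def by (intro uq_ring.genideal_minimal)
  then show ?thesis using p by auto
qed

text \<open>A coset acts through an arbitrary representative. Two representatives differ by an
  element of the ideal, so the choice is harmless as soon as the relations act by zero.\<close>

definition uq_action ::
  "complex \<Rightarrow> (uq_gen \<Rightarrow> 'b \<Rightarrow> ('b \<Rightarrow>\<^sub>0 complex)) \<Rightarrow> uq_free set \<Rightarrow> ('b \<Rightarrow>\<^sub>0 complex) \<Rightarrow> ('b \<Rightarrow>\<^sub>0 complex)"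
where
  "uq_action t G u = rep G (SOME p. u = uq_class t p)"

lemma uq_action_class:
  assumes "\<And>p b. p \<in> relations t \<Longrightarrow> rep G p (bvec b) = 0"
  shows "uq_action t G (uq_class t p) v = rep G p v"
proof -
  define p' where "p' = (SOME p'. uq_class t p = uq_class t p')"
  have "uq_class t p = uq_class t p'"
    unfolding p'_def by (rule someI) simp
  then have "rep G (p - p') v = 0"
    using rep_rel_ideal[OF assms uq_class_eqD] by blast
  then show ?thesis
    by (simp add: uq_action_def p'_def rep_diff_left)
qed

lemma uq_module_uq_action:
  assumes rel: "\<And>p b. p \<in> relations t \<Longrightarrow> rep G p (bvec b) = 0"
    and G: "\<And>g b. b \<in> B \<Longrightarrow> G g b \<in> vs.span (bvec ` B)"
  shows "uq_module t (vs.span (bvec ` B)) (uq_action t G)"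
proof -
  have "rep G p v \<in> vs.span (bvec ` B)" if "v \<in> vs.span (bvec ` B)" for p v
    using that by (intro rep_in_subspace lin_span[of B]) (auto simp: G vs.subspace_span)
  then show ?thesis
    by (auto simp: uq_module_def carrier_Uq uq_class_add uq_class_mult uq_class_one
        uq_action_class[OF rel] rep_add_right rep_add_left rep_mult)
qed

section \<open>Combinatorics of columns\<close>

lemma qpow_1 [simp]: "qpow t 1 = exp t"
  by (simp add: qpow_def)

lemma qpow_neg_1 [simp]: "qpow t (- 1) = inverse (exp t)"
  by (simp add: qpow_def exp_minus)

lemma qpow_neq_0 [simp]: "qpow t r \<noteq> 0"
  by (simp add: qpow_def)

lemma qpow_0 [simp]: "qpow t 0 = 1"
  by (simp add: qpow_def)

lemma qpow_add: "qpow t (r + r') = qpow t r * qpow t r'"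
  by (simp add: qpow_def of_rat_add distrib_left exp_add)

lemma qpow_of_int_add: "qpow t (of_int (m + n)) = qpow t (of_int m) * qpow t (of_int n)"
  by (simp only: of_int_add qpow_add)

lemma qdiff_eq: "qdiff t = exp t - inverse (exp t)"
  by (simp add: qdiff_def)

text \<open>\<open>fps_ln 1\<close> is the series log(1 + X), so this is log F when F has constant
  term 1.\<close>

definition fps_log :: "complex fps \<Rightarrow> complex fps" where
  "fps_log F = fps_ln 1 oo (F - 1)"

lemma fps_log_nth_0 [simp]: "fps_log F $ 0 = 0"
  by (simp add: fps_log_def)

lemma fps_exp_compose_log:
  assumes "F $ 0 = 1"
  shows "fps_exp 1 oo fps_log F = F"
proof -
  have "(fps_exp 1 - 1) oo fps_log F = ((fps_exp 1 - 1) oo fps_ln 1) oo (F - 1)"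
    unfolding fps_log_def using assms by (intro fps_compose_assoc) auto
  also have "(fps_exp 1 - 1) oo fps_ln (1 :: complex) = fps_X"
    using fps_inv_fps_exp_compose(2)[of "1 :: complex"] by (simp add: fps_ln_fps_exp_inv)
  also have "fps_X oo (F - 1) = F - 1"
    using assms by (intro fps_X_fps_compose_startby0) auto
  finally show ?thesis
    by (simp add: fps_compose_sub_distrib)
qed

text \<open>
  \<open>phi_coeff t s n y m\<close> is the coefficient of \<open>z\<^sup>m\<close> in the expansion of
  \<open>(q\<^sup>n - q\<^sup>-\<^sup>n y z) / (1 - y z)\<close>, which covers the eigenvalues \<open>\<psi>(y z)\<close> for \<open>n = 1\<close>,
  \<open>\<psi>(q\<^sup>2 y z)\<^sup>-\<^sup>1\<close> for \<open>n = - 1\<close>, and \<open>1\<close> for \<open>n = 0\<close>.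
\<close>

definition phi_coeff :: "complex \<Rightarrow> sign \<Rightarrow> int \<Rightarrow> complex \<Rightarrow> int \<Rightarrow> complex" where
  "phi_coeff t s n y m =
     (if m = 0 then qpow t (of_int (sg s * n))
      else if sg s * m > 0 then of_int (sg s * n) * qdiff t * y powi m else 0)"

section \<open>Exchanging two consecutive values of a column\<close>

definition swp :: "int \<Rightarrow> int list \<Rightarrow> int list" where
  "swp i = map (Transposition.transpose i (i + 1))"

text \<open>The pairing of the weight of the column with h_i: it is 1 where the lowering operator
  applies, -1 where the raising operator applies, and 0 where both vanish.\<close>

definition occ :: "int \<Rightarrow> int list \<Rightarrow> int" where
  "occ i T = of_bool (i \<in> set T) - of_bool (i + 1 \<in> set T)"

text \<open>If exactly one of \<open>i\<close> and \<open>i + 1\<close> is an entry of a strictly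
  increasing list, this is its position counted from 1. It depends on the set of entries only and so
  makes sense on all lists.\<close>

definition rank :: "int \<Rightarrow> int list \<Rightarrow> nat" where
  "rank i T = card {x \<in> set T. x \<le> i + 1}"

text \<open>The parameter b q^(i + l + 1 - 2p) of the extremal module at b = a q^(1 - l), where l
  cancels; p is the rank.\<close>

definition spec :: "complex \<Rightarrow> complex \<Rightarrow> int \<Rightarrow> int list \<Rightarrow> complex" where
  "spec t a i T = a * qpow t (of_int (i + 2 - 2 * int (rank i T)))"

lemma mem_swp: "x \<in> set (swp i T) \<longleftrightarrow> Transposition.transpose i (i + 1) x \<in> set T"
  by (auto simp: swp_def intro: image_eqI[of _ _ "Transposition.transpose i (i + 1) x"])

lemma swp_swp [simp]: "swp i (swp i T) = T"
  by (simp add: swp_def comp_def)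

lemma swp_commute: "\<bar>i - j\<bar> \<ge> 2 \<Longrightarrow> swp i (swp j T) = swp j (swp i T)"
  by (auto simp: swp_def Transposition.transpose_def)

lemma occ_cases: "occ i T = -1 \<or> occ i T = 0 \<or> occ i T = 1"
  by (auto simp: occ_def)

text \<open>The exchange reflects the weight in the simple root alpha_i, which changes the pairing
  with h_j by a multiple of the Cartan entry.\<close>

lemma occ_swp: "occ j (swp i T) = occ j T - cartan_entry i j * occ i T"
  by (auto simp: occ_def mem_swp Transposition.transpose_def cartan_entry_def)

text \<open>Counting entries up to \<open>j + 1\<close> notices the exchange only if this threshold
  separates \<open>i\<close> from \<open>i + 1\<close>, that is, if
  \<open>j + 1 = i\<close>.\<close>

lemma rank_swp: "int (rank j (swp i T)) = int (rank j T) - (if j = i - 1 then occ i T else 0)"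
proof -
  have "{x \<in> set (swp i T). x \<le> j + 1} =
        Transposition.transpose i (i + 1) ` {x \<in> set T. Transposition.transpose i (i + 1) x \<le> j + 1}"
    by (auto simp: swp_def)
  then have card: "rank j (swp i T) = card {x \<in> set T. Transposition.transpose i (i + 1) x \<le> j + 1}"
    by (simp add: rank_def card_image)
  show ?thesis
  proof (cases "j = i - 1")
    case False
    then have "Transposition.transpose i (i + 1) x \<le> j + 1 \<longleftrightarrow> x \<le> j + 1" for x
      by (auto simp: Transposition.transpose_def)
    then show ?thesis
      using False by (simp add: card) (simp add: rank_def)
  next
    case True
    define B where "B = {x \<in> set T. x < i}"
    have B: "finite B" "i \<notin> B" "i + 1 \<notin> B"
      by (auto simp: B_def)
    have swp: "{x \<in> set T. Transposition.transpose i (i + 1) x \<le> j + 1} =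
          B \<union> (if i + 1 \<in> set T then {i + 1} else {})"
      using True by (auto simp: B_def Transposition.transpose_def split: if_splits)
    have "{x \<in> set T. x \<le> j + 1} = B \<union> (if i \<in> set T then {i} else {})"
      using True by (auto simp: B_def order_le_less)
    then have "rank j T = card (B \<union> (if i \<in> set T then {i} else {}))"
      by (simp add: rank_def)
    then show ?thesis
      using True B unfolding card swp by (simp add: occ_def)
  qed
qed

lemma rank_Suc: "rank (i + 1) T = rank i T + of_bool (i + 2 \<in> set T)"
proof -
  have "x \<le> i + 2 \<longleftrightarrow> x \<le> i + 1 \<or> x = i + 2" for x
    by linarith
  then have "{x \<in> set T. x \<le> i + 2} = {x \<in> set T. x \<le> i + 1} \<union> (if i + 2 \<in> set T then {i + 2} else {})"
    by auto
  then show ?thesis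
    by (simp add: rank_def add.commute)
qed

lemma spec_neq_0 [simp]: "a \<noteq> 0 \<Longrightarrow> spec t a i T \<noteq> 0"
  by (simp add: spec_def)

lemma spec_swp:
  "spec t a j (swp i T) = spec t a j T * (if j = i - 1 then qpow t (of_int (2 * occ i T)) else 1)"
proof -
  have "j + 2 - 2 * int (rank j (swp i T)) =
        j + 2 - 2 * int (rank j T) + (if j = i - 1 then 2 * occ i T else 0)"
    by (simp add: rank_swp)
  then show ?thesis
    by (simp only: spec_def qpow_of_int_add) simp
qed

lemma spec_Suc:
  "spec t a (i + 1) T = spec t a i T * qpow t (of_int (1 - 2 * of_bool (2 + i \<in> set T)))"
proof -
  have "(i + 1) + 2 - 2 * int (rank (i + 1) T) =
        i + 2 - 2 * int (rank i T) + (1 - 2 * of_bool (2 + i \<in> set T))"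
    using rank_Suc[of i T] by (simp add: add.commute[of 2 i])
  then show ?thesis
    by (simp only: spec_def qpow_of_int_add mult.assoc)
qed

text \<open>This places the delta functions of x_i(z) x_j(w) T on the locus w = q^(-s) z, where the
  factor w - q^(-s) z of the relation for neighbours vanishes. For \<open>i = j + 1\<close> the
  shift comes from \<open>spec_Suc\<close> alone, for \<open>j = i + 1\<close> also from
  \<open>spec_swp\<close>.\<close>

lemma spec_neighbour:
  assumes "\<bar>i - j\<bar> = 1" "occ i T = 0" "occ j T = - sg s"
  shows "spec t a i (swp j T) = qpow t (of_int (- sg s)) * spec t a j T"
proof -
  consider "i = j + 1" | "j = i + 1" using assms(1) by linarith
  then show ?thesis
  proof cases
    case 1
    then show ?thesis
      using assms by (cases s) (auto simp: spec_swp spec_Suc occ_def of_bool_def split: if_splits)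
  next
    case 2
    have "spec t a i (swp j T) =
      spec t a i T * (if s = Pos then qpow t (of_int (-2)) else qpow t (of_int 2))"
      using 2 assms by (cases s) (auto simp: spec_swp)
    moreover have "qpow t 2 = qpow t 1 * qpow t 1" "qpow t (- 2) = qpow t (- 1) * qpow t (- 1)"
      using qpow_add[of t 1 1] qpow_add[of t "- 1" "- 1"] by simp_all
    moreover have "2 + i \<in> set T \<longleftrightarrow> s = Pos"
      using assms(2,3) 2 by (cases s) (auto simp: occ_def of_bool_def add.commute split: if_splits)
    ultimately show ?thesis
      using 2 by (cases s) (auto simp: spec_Suc)
  qed
qed

section \<open>Weights and the operators k_h\<close>

lemma box_weight_add: "box_weight x (h + h') = box_weight x h + box_weight x h'"
  by (simp add: box_weight_def fund_weight_def lookup_add)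

lemma box_weight_uminus: "box_weight x (- h) = - box_weight x h"
  by (simp add: box_weight_def fund_weight_def)

lemma ext_k_add: "ext_k t (h + h') T = ext_k t h T * ext_k t h' T"
  by (simp add: ext_k_def box_weight_add sum.distrib qpow_add)

lemma ext_k_0 [simp]: "ext_k t 0 T = 1"
  by (simp add: ext_k_def box_weight_def fund_weight_def)

lemma sum_box_weight_coroot: "(\<Sum>j\<in>set T. box_weight j (coroot i)) = of_int (occ i T)"
proof -
  have "box_weight j (coroot i) = (if i = j then 1 else 0) - (if i + 1 = j then 1 else 0)" for j
    by (auto simp: box_weight_def fund_weight_def coroot_def lookup_single when_def)
  then show ?thesis
    by (simp add: sum_subtractf occ_def)
qed

lemma ext_k_coroot:
  "ext_k t (case s of Pos \<Rightarrow> coroot i | Neg \<Rightarrow> - coroot i) T = qpow t (of_int (sg s * occ i T))"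
  by (cases s) (auto simp: ext_k_def sum_box_weight_coroot box_weight_uminus sum_negf)

lemma ext_k_swp:
  "ext_k t h (swp j T) = ext_k t h T * qpow t (- of_int (occ j T) * simple_root j h)"
proof -
  let ?\<tau> = "Transposition.transpose j (j + 1)"
  have "(\<Sum>x\<in>set (swp j T). box_weight x h) = (\<Sum>x\<in>set T. box_weight (?\<tau> x) h)"
    by (simp add: swp_def sum.reindex)
  \<comment> \<open>The weights of the boxes \<open>j\<close> and \<open>j + 1\<close> differ by
    alpha_j, which is lost at an entry \<open>j\<close> and gained at an entry
    \<open>j + 1\<close>.\<close>
  also have "\<dots> = (\<Sum>x\<in>set T. box_weight x h - (if j = x then simple_root j h else 0)
                      + (if j + 1 = x then simple_root j h else 0))"
    by (intro sum.cong)
      (auto simp: Transposition.transpose_def box_weight_def simple_root_def)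
  also have "\<dots> = (\<Sum>x\<in>set T. box_weight x h) + (- of_int (occ j T) * simple_root j h)"
    by (simp add: sum.distrib sum_subtractf occ_def algebra_simps)
  finally show ?thesis
    by (simp only: ext_k_def qpow_add)
qed

section \<open>The defining relations\<close>

text \<open>
  The action is defined on all lists, not only on the tableaux: it depends on a list only through its
  set of entries, so the relations hold without any sortedness assumption. The eigenvalue of
  \<open>h\<^bsub>i,m\<^esub>\<close> is a coefficient of the logarithm of the normalised eigenvalue of \<open>\<phi>\<^sub>i\<^sup>\<plusminus>(z)\<close>.
\<close>

definition ext_gen :: "complex \<Rightarrow> complex \<Rightarrow> uq_gen \<Rightarrow> int list \<Rightarrow> (int list \<Rightarrow>\<^sub>0 complex)" where
  "ext_gen t a g T =
     (case g of
        XGen s i r \<Rightarrow> if occ i T = - sg s then Poly_Mapping.single (swp i T) (spec t a i T powi r) else 0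
      | KGen h \<Rightarrow> Poly_Mapping.single T (ext_k t h T)
      | HGen s i m \<Rightarrow> Poly_Mapping.single T
          (fps_log (Abs_fps (\<lambda>k. phi_coeff t s (occ i T) (spec t a i T) (sg s * int k)
              / qpow t (of_int (sg s * occ i T)))) $ Suc m / (of_int (sg s) * qdiff t)))"

lemma rep_XGen:
  "rep (ext_gen t a) (xg s i r) (Poly_Mapping.single T c) =
     (if occ i T = - sg s then Poly_Mapping.single (swp i T) (c * spec t a i T powi r) else 0)"
  by (simp add: rep_gen ext_gen_def)

lemma rep_KGen:
  "rep (ext_gen t a) (gen (KGen h)) (Poly_Mapping.single T c) = Poly_Mapping.single T (c * ext_k t h T)"
  by (simp add: rep_gen ext_gen_def)

section \<open>Eigenvalues of power series of operators\<close>

definition eigenvalue ::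
  "(uq_gen \<Rightarrow> 'b \<Rightarrow> ('b \<Rightarrow>\<^sub>0 complex)) \<Rightarrow> 'b \<Rightarrow> uq_free \<Rightarrow> complex \<Rightarrow> bool"
where
  "eigenvalue G b p c \<longleftrightarrow> rep G p (bvec b) = vscale c (bvec b)"

lemma eigenvalue_sum:
  assumes "finite A" "\<And>x. x \<in> A \<Longrightarrow> eigenvalue G b (p x) (c x)"
  shows "eigenvalue G b (sum p A) (sum c A)"
  using assms by (induction A rule: finite_induct)
    (auto simp: eigenvalue_def rep_add_left vs.scale_left_distrib)

lemma eigenvalue_mult:
  "eigenvalue G b p c \<Longrightarrow> eigenvalue G b p' c' \<Longrightarrow> eigenvalue G b (p * p') (c * c')"
  by (simp add: eigenvalue_def rep_mult rep_vscale_right mult_ac)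

lemma eigenvalue_scal: "eigenvalue G b (scal c) c"
  by (simp add: eigenvalue_def)

lemma eigenvalue_fps_power:
  assumes "\<And>k. eigenvalue G b (U $ k) (u $ k)"
  shows "eigenvalue G b (U ^ n $ k) (u ^ n $ k)"
proof (induction n arbitrary: k)
  case 0
  then show ?case
    using eigenvalue_scal[of G b 1] by (simp add: eigenvalue_def)
next
  case (Suc n)
  then show ?case
    by (auto simp: fps_mult_nth intro!: eigenvalue_sum eigenvalue_mult assms)
qed

text \<open>On a common eigenvector of the coefficients, sums and products of operators become sums
  and products of scalars; for the coefficient at \<open>k\<close> both exponentials run over the
  powers up to \<open>k\<close>.\<close>

lemma eigenvalue_fps_expo:
  assumes "\<And>k. eigenvalue G b (U $ k) (u $ k)"
  shows "eigenvalue G b (fps_expo U $ k) ((fps_exp 1 oo u) $ k)"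
proof -
  have "(fps_exp 1 oo u) $ k = (\<Sum>n\<le>k. 1 / fact n * u ^ n $ k)"
    by (simp add: fps_compose_nth atLeast0AtMost)
  moreover have "eigenvalue G b (fps_expo U $ k) (\<Sum>n\<le>k. 1 / fact n * u ^ n $ k)"
    unfolding fps_expo_def fps_nth_Abs_fps
    by (intro eigenvalue_sum eigenvalue_mult eigenvalue_scal eigenvalue_fps_power assms) simp
  ultimately show ?thesis by simp
qed

text \<open>The eigenvalues of the h_(i,m) were taken from a logarithm, divided by s (q - q^-1).
  Exponentiating returns the normalised series, and the factor k restores the constant term removed
  by the normalisation.\<close>

lemma rep_phi:
  assumes q: "qdiff t \<noteq> 0"
  shows "rep (ext_gen t a) (phi t s i m) (Poly_Mapping.single T c) =
    Poly_Mapping.single T (c * phi_coeff t s (occ i T) (spec t a i T) m)"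
proof -
  let ?e = "phi_coeff t s (occ i T) (spec t a i T)"
  let ?q = "qpow t (of_int (sg s * occ i T))"
  define F where "F = Abs_fps (\<lambda>k. ?e (sg s * int k) / ?q)"
  define U where "U = Abs_fps (\<lambda>m. if m = 0 then 0
    else scal (of_int (sg s) * qdiff t) * gen (HGen s i (m - 1)))"
  have "eigenvalue (ext_gen t a) T (U $ k) (fps_log F $ k)" for k
    using q by (cases k; cases s)
      (auto simp: U_def eigenvalue_def rep_mult rep_gen ext_gen_def F_def vscale_bvec)
  then have exp: "eigenvalue (ext_gen t a) T (fps_expo U $ k) (F $ k)" for k
    using eigenvalue_fps_expo[of "ext_gen t a" T U "fps_log F" k]
    by (subst (asm) fps_exp_compose_log) (auto simp: F_def phi_coeff_def)
  have series: "eigenvalue (ext_gen t a) T (phi_series t s i $ k) (?q * F $ k)" for k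
    unfolding phi_series_def U_def[symmetric]
    by (auto intro!: eigenvalue_mult exp simp: eigenvalue_def[of _ _ "gen _"] rep_gen ext_gen_def vscale_bvec ext_k_coroot)
  have "eigenvalue (ext_gen t a) T (phi t s i m) (?e m)"
  proof (cases "sg s * m \<ge> 0")
    case True
    then have "sg s * int (nat (sg s * m)) = m"
      by (cases s) auto
    then have "?q * F $ nat (sg s * m) = ?e m"
      by (simp only: F_def fps_nth_Abs_fps) simp
    with True show ?thesis
      using series[of "nat (sg s * m)"] by (simp add: phi_def)
  next
    case False
    then have "?e m = 0"
      by (auto simp: phi_coeff_def)
    with False show ?thesis
      by (simp add: phi_def eigenvalue_def)
  qed
  then show ?thesis
    by (simp add: eigenvalue_def vscale_bvec[symmetric] rep_vscale_right)
qed

text \<open>The coefficient of z^r in (1 - Q Y z) phi'(z) = (Q - Y z) phi(z), which is the relation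
  between phi_i and x_j with w set to 1/Y; the prime marks the column after raising. The four cases
  are i = j, a neighbour whose \<open>occ\<close> drops from 1 to 0, one whose \<open>occ\<close>
  drops from 0 to -1, and an unchanged eigenvalue.\<close>

lemma phi_coeff_exchange:
  assumes Y: "Y \<noteq> 0" "y \<noteq> 0" "y' \<noteq> 0"
    and "n = - 1 \<and> n' = 1 \<and> y = Y \<and> y' = Y \<and> Q = exp t * exp t \<or>
         n = 1 \<and> n' = 0 \<and> y = exp t * Y \<and> Q = inverse (exp t) \<or>
         n = 0 \<and> n' = - 1 \<and> y' = inverse (exp t) * Y \<and> Q = inverse (exp t) \<or>
         n = n' \<and> y = y' \<and> Q = 1"
  shows "phi_coeff t e n' y' r - Q * Y * phi_coeff t e n' y' (r - 1) =
         Q * phi_coeff t e n y r - Y * phi_coeff t e n y (r - 1)"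
proof -
  define u where "u = exp t"
  have u: "u \<noteq> 0"
    by (simp add: u_def)
  consider "r = 0" | "r = 1" | "r < 0 \<or> r > 1" by linarith
  then show ?thesis
  proof cases
    case 1
    then have *: "phi_coeff t e m x r = qpow t (of_int (sg e * m))"
        "phi_coeff t e m x (r - 1) = (if e = Pos then 0 else - of_int m * qdiff t / x)" for m x
      by (cases e; simp add: phi_coeff_def power_int_minus divide_inverse)+
    show ?thesis
      unfolding * qdiff_eq using assms u
      by (cases e; elim disjE conjE) (simp_all flip: u_def, simp_all add: field_simps)
  next
    case 2
    then have *: "phi_coeff t e m x r = (if e = Pos then of_int m * qdiff t * x else 0)"
        "phi_coeff t e m x (r - 1) = qpow t (of_int (sg e * m))" for m x
      by (cases e; simp add: phi_coeff_def)+
    show ?thesis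
      unfolding * qdiff_eq using assms u
      by (cases e; elim disjE conjE) (simp_all flip: u_def, simp_all add: field_simps)
  next
    case 3
    \<comment> \<open>Here r and r - 1 lie strictly on the same side of 0, so both coefficients
      carry a common factor, which is 0 on the side where the expansion has no terms.\<close>
    define K where "K = (if r > 1 \<and> e = Pos then qdiff t else if r < 0 \<and> e = Neg then - qdiff t else 0)"
    have *: "phi_coeff t e m x r = of_int m * (K * x powi (r - 1)) * x"
        "phi_coeff t e m x (r - 1) = of_int m * (K * x powi (r - 1))" if "x \<noteq> 0" for m x
      using 3 that power_int_add[of x "r - 1" 1] by (cases e; auto simp: phi_coeff_def K_def)+
    obtain c c' where c: "c = K * y powi (r - 1)" "c' = K * y' powi (r - 1)" by blast
    then have cc: "y = y' \<Longrightarrow> c = c'" by simp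
    have "of_int n' * c' * y' - Q * Y * (of_int n' * c') = Q * (of_int n * c * y) - Y * (of_int n * c)"
      using assms(4) cc by (elim disjE conjE) (simp_all add: algebra_simps)
    then show ?thesis
      unfolding *[OF Y(2)] *[OF Y(3)] c .
  qed
qed

text \<open>The two expansions of a fraction with a simple pole differ by a multiple of a delta
  function. The range of \<open>n\<close> matters at \<open>m = 0\<close>, where q^n - q^-n = n (q -
  q^-1) is used.\<close>

lemma phi_coeff_diff:
  assumes "qdiff t \<noteq> 0" "n \<in> {- 1, 0, 1}"
  shows "(phi_coeff t Pos n y m - phi_coeff t Neg n y m) / qdiff t = of_int n * y powi m"
proof -
  have "inverse (exp t) - exp t = - qdiff t" "exp t - inverse (exp t) = qdiff t"
    by (simp_all add: qdiff_eq)
  then show ?thesis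
    using assms by (auto simp: phi_coeff_def minus_divide_left[symmetric])
qed

lemma phi_coeff_exchange_swp:
  fixes t a :: complex and e s :: sign and i j :: int and T :: "int list"
  assumes a: "a \<noteq> 0" and j: "occ j T = - sg s"
  defines "Q \<equiv> qpow t (of_int (sg s * cartan_entry i j))"
    and "E \<equiv> phi_coeff t e (occ i T) (spec t a i T)"
    and "E' \<equiv> phi_coeff t e (occ i (swp j T)) (spec t a i (swp j T))"
  shows "E' r - Q * spec t a j T * E' (r - 1) = Q * E r - spec t a j T * E (r - 1)"
proof -
  note exchange = phi_coeff_exchange[OF spec_neq_0 spec_neq_0 spec_neq_0, OF a a a]
  have pos: "phi_coeff t e (occ i (swp j U)) (spec t a i (swp j U)) r -
        qpow t (of_int (cartan_entry i j)) * spec t a j U * phi_coeff t e (occ i (swp j U)) (spec t a i (swp j U)) (r - 1) =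
      qpow t (of_int (cartan_entry i j)) * phi_coeff t e (occ i U) (spec t a i U) r -
        spec t a j U * phi_coeff t e (occ i U) (spec t a i U) (r - 1)"
    if U: "occ j U = - 1" for U
  proof (rule exchange)
    have q2: "qpow t 2 = exp t * exp t"
      using qpow_add[of t 1 1] by simp
    consider (eq) "i = j" | (near) "\<bar>i - j\<bar> = 1" | (far) "\<bar>i - j\<bar> \<ge> 2" by linarith
    then show "occ i U = - 1 \<and> occ i (swp j U) = 1 \<and> spec t a i U = spec t a j U \<and>
        spec t a i (swp j U) = spec t a j U \<and> qpow t (of_int (cartan_entry i j)) = exp t * exp t \<or>
      occ i U = 1 \<and> occ i (swp j U) = 0 \<and> spec t a i U = exp t * spec t a j U \<and>
        qpow t (of_int (cartan_entry i j)) = inverse (exp t) \<or>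
      occ i U = 0 \<and> occ i (swp j U) = - 1 \<and> spec t a i (swp j U) = inverse (exp t) * spec t a j U \<and>
        qpow t (of_int (cartan_entry i j)) = inverse (exp t) \<or>
      occ i U = occ i (swp j U) \<and> spec t a i U = spec t a i (swp j U) \<and>
        qpow t (of_int (cartan_entry i j)) = 1"
    proof cases
      case eq
      then show ?thesis
        using U by (simp add: occ_swp spec_swp cartan_entry_def q2)
    next
      case near
      then have C: "cartan_entry i j = -1" "cartan_entry j i = -1"
        by (auto simp: cartan_entry_def)
      have occ: "occ i (swp j U) = occ i U - 1"
        using U C by (simp add: occ_swp)
      then consider "occ i U = 1" | "occ i U = 0"
        using occ_cases[of i U] occ_cases[of i "swp j U"] by linarith
      then show ?thesis
      proof cases
        case 1
        \<comment> \<open>After raising, \<open>occ i\<close> is 0, so the neighbour lemma is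
          applied to the way back from \<open>swp j U\<close> to \<open>U\<close>, a
          lowering.\<close>
        have "spec t a i (swp j (swp j U)) = qpow t (of_int (- sg Neg)) * spec t a j (swp j U)"
          using near 1 U occ C by (intro spec_neighbour) (auto simp: occ_swp cartan_entry_def)
        then show ?thesis
          using 1 occ C by (simp add: spec_swp)
      next
        case 2
        have "spec t a i (swp j U) = qpow t (of_int (- sg Pos)) * spec t a j U"
          using near 2 U by (intro spec_neighbour) auto
        then show ?thesis
          using 2 occ C by simp
      qed
    next
      case far
      then show ?thesis
        by (auto simp: occ_swp spec_swp cartan_entry_def)
    qed
  qed
  show ?thesis
  proof (cases s)
    case Pos
    then show ?thesis
      using pos[of T] j by (simp add: Q_def E_def E'_def)
  next
    case Neg
    \<comment> \<open>Lowering \<open>T\<close> is undone by raising \<open>swp j T\<close>. The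
      raising identity for that column, multiplied by \<open>Q\<close>, is the claim read from right
      to left.\<close>
    then have "occ j (swp j T) = - 1"
      using j by (simp add: occ_swp cartan_entry_def)
    moreover have "Q * qpow t (of_int (cartan_entry i j)) = 1"
      using Neg qpow_of_int_add[of t "- cartan_entry i j" "cartan_entry i j"] by (simp add: Q_def)
    moreover have "spec t a j (swp j T) = spec t a j T"
      by (simp add: spec_swp)
    ultimately show ?thesis
      using arg_cong[OF pos[of "swp j T"], of "\<lambda>x. Q * x"]
      by (simp add: E_def E'_def right_diff_distrib flip: mult.assoc)
  qed
qed

lemma rep_relations:
  assumes q: "qdiff t \<noteq> 0" and a: "a \<noteq> 0" and p: "p \<in> relations t"
  shows "rep (ext_gen t a) p (bvec T) = 0"
proof -
  note evals = bvec_def rep_add_left rep_diff_left rep_mult rep_XGen rep_KGen rep_phi[OF q]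
    qC_def serre_half_def
  consider
      (kk) h h' where "p = gen (KGen h) * gen (KGen h') - gen (KGen (h + h'))"
    | (k0) "p = gen (KGen 0) - 1"
    | (kphi) h s i m where "p = gen (KGen h) * phi t s i m - phi t s i m * gen (KGen h)"
    | (phiphi) s i m s' j n where "p = phi t s i m * phi t s' j n - phi t s' j n * phi t s i m"
    | (kx) h s j r where "p = gen (KGen h) * xg s j r * gen (KGen (- h))
        - scal (qpow t (of_int (sg s) * simple_root j h)) * xg s j r"
    | (phix) e s i j r n where
        "p = (phi t e i r * xg s j (n - 1) - qC t s i j * phi t e i (r - 1) * xg s j n)
        - (qC t s i j * xg s j (n - 1) * phi t e i r - xg s j n * phi t e i (r - 1))"
    | (pm) i j r n where "p = (xg Pos i r * xg Neg j n - xg Neg j n * xg Pos i r)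
        - (if i = j then scal (1 / qdiff t) * (phi t Pos i (r + n) - phi t Neg i (r + n)) else 0)"
    | (xx) s i j r n where
        "p = (xg s i r * xg s j (n - 1) - qC t s i j * xg s i (r - 1) * xg s j n)
        - (qC t s i j * xg s j (n - 1) * xg s i r - xg s j n * xg s i (r - 1))"
    | (serre) s i j r1 r2 n where
        "p = serre_half t s i j r1 r2 n + serre_half t s i j r2 r1 n" "\<bar>i - j\<bar> = 1"
    | (far) s i j r n where "p = xg s i r * xg s j n - xg s j n * xg s i r" "\<bar>i - j\<bar> \<ge> 2"
    using p unfolding relations_def by (elim UnE CollectE exE conjE insertE) auto
  then show ?thesis
  proof cases
    case kk
    then show ?thesis by (simp add: evals ext_k_add mult_ac)
  next
    case k0
    then show ?thesis by (simp add: evals)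
  next
    case kphi
    then show ?thesis by (simp add: evals mult_ac)
  next
    case phiphi
    then show ?thesis by (simp add: evals mult_ac)
  next
    case kx
    have inv: "ext_k t h T * (ext_k t (- h) T * x) = x" for x
      by (simp flip: ext_k_add mult.assoc)
    then show ?thesis
      by (simp add: kx evals ext_k_swp mult_ac inv)
  next
    case phix
    have a': "spec t a i U \<noteq> 0" for i U using a by simp
    show ?thesis
    proof (cases "occ j T = - sg s")
      case True
      let ?Q = "qpow t (of_int (sg s * cartan_entry i j))"
      let ?Y = "spec t a j T"
      let ?E = "phi_coeff t e (occ i T) (spec t a i T)"
      let ?E' = "phi_coeff t e (occ i (swp j T)) (spec t a i (swp j T))"
      have exchange: "?E' r - ?Q * ?Y * ?E' (r - 1) = ?Q * ?E r - ?Y * ?E (r - 1)"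
        by (rule phi_coeff_exchange_swp[OF a True])
      have "?Y powi n = ?Y powi (n - 1) * ?Y"
        using power_int_add[of ?Y "n - 1" 1] a' by simp
      then have "?Y powi (n - 1) * ?E' r - ?Q * (?Y powi n * ?E' (r - 1)) =
          ?Q * (?E r * ?Y powi (n - 1)) - ?E (r - 1) * ?Y powi n"
        using arg_cong[OF exchange, of "\<lambda>x. ?Y powi (n - 1) * x"] by (simp add: algebra_simps)
      then show ?thesis
        using True by (simp add: phix evals flip: single_diff)
    qed (simp add: phix evals)
  next
    case pm
    show ?thesis
    proof (cases "i = j")
      case True
      let ?Y = "spec t a j T"
      \<comment> \<open>Both sides have coefficient \<open>occ j T\<close> times Y^(r + n): at most
        one product in the commutator survives, and the exchange keeps the parameter while reversing
        the sign of \<open>occ\<close>.\<close>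
      have diff: "(phi_coeff t Pos (occ j T) ?Y (r + n) - phi_coeff t Neg (occ j T) ?Y (r + n)) / qdiff t
          = of_int (occ j T) * (?Y powi r * ?Y powi n)"
        using q a occ_cases[of j T] by (subst phi_coeff_diff) (auto simp: power_int_add)
      have swp: "spec t a j (swp j T) = ?Y" "occ j (swp j T) = - occ j T"
        by (simp_all add: spec_swp occ_swp cartan_entry_def)
      consider "occ j T = -1" | "occ j T = 0" | "occ j T = 1" using occ_cases by blast
      then show ?thesis
        using True diff q by cases (simp_all add: pm evals swp mult_ac
            flip: single_diff single_uminus)
    next
      case False
      \<comment> \<open>For neighbours a nonzero product would need \<open>occ\<close> to be 2 or -2
        on \<open>T\<close>; for distant indices the exchanges commute.\<close>
      then show ?thesis
        using occ_cases[of i T] occ_cases[of j T] swp_commute[of i j T]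
        by (auto simp: pm evals occ_swp spec_swp cartan_entry_def mult_ac split: if_splits)
    qed
  next
    case xx
    consider (eq) "i = j" | (near) "\<bar>i - j\<bar> = 1" | (far) "\<bar>i - j\<bar> \<ge> 2" by linarith
    then show ?thesis
    proof cases
      case eq
      then show ?thesis by (cases s) (simp_all add: xx evals occ_swp cartan_entry_def)
    next
      case near
      have *: "cartan_entry i j = -1" "cartan_entry j i = -1"
        using near by (auto simp: cartan_entry_def)
      let ?Q = "qpow t (of_int (- sg s))"
      \<comment> \<open>The two sides of the relation vanish separately: this is (w - q^(-s) z)
        x_i(z) x_j(w) = 0 in coefficients, and exchanging the indices and variables handles the
        other side.\<close>
      have vanish: "rep (ext_gen t a) (xg s i' r' * xg s j' (n' - 1)) (Poly_Mapping.single T 1) =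
          vscale ?Q (rep (ext_gen t a) (xg s i' (r' - 1) * xg s j' n') (Poly_Mapping.single T 1))"
        if "\<bar>i' - j'\<bar> = 1" for i' j' r' n'
      proof (cases "occ j' T = - sg s \<and> occ i' T = 0")
        case True
        let ?Y = "spec t a j' T" and ?Z = "spec t a i' (swp j' T)"
        have "cartan_entry j' i' = -1"
          using that by (auto simp: cartan_entry_def)
        moreover have "?Y powi n' = ?Y powi (n' - 1) * ?Y" "?Z powi r' = ?Z powi (r' - 1) * ?Z"
          using power_int_add[of ?Y "n' - 1" 1] power_int_add[of ?Z "r' - 1" 1] a by simp_all
        moreover have "?Z = ?Q * ?Y"
          using that True by (intro spec_neighbour) auto
        ultimately show ?thesis
          using True by (simp add: evals occ_swp mult_ac)
      next
        case False
        have "cartan_entry j' i' = -1"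
          using that by (auto simp: cartan_entry_def)
        then show ?thesis
          using False by (auto simp: evals occ_swp)
      qed
      have "qC t s i j = scal ?Q"
        using * by (simp add: qC_def)
      moreover have "vscale ?Q (rep (ext_gen t a) (xg s j (n - 1) * xg s i r) (Poly_Mapping.single T 1)) =
          rep (ext_gen t a) (xg s j n * xg s i (r - 1)) (Poly_Mapping.single T 1)"
        using vanish[of j i n r] near by simp
      ultimately show ?thesis
        using vanish[of i j r n] near
        by (simp add: xx bvec_def rep_diff_left mult.assoc)
           (simp add: rep_mult)
    next
      case far
      then have "cartan_entry i j = 0" "cartan_entry j i = 0" "i \<noteq> j - 1" "j \<noteq> i - 1"
        by (auto simp: cartan_entry_def)
      then show ?thesis
        using swp_commute[OF far, of T] by (simp add: xx evals occ_swp spec_swp mult_ac)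
    qed
  next
    case serre
    then have "cartan_entry i j = -1" "cartan_entry j i = -1" "cartan_entry i i = 2"
      by (auto simp: cartan_entry_def)
    \<comment> \<open>Every Serre monomial vanishes by itself: \<open>occ i\<close> must be -s
      before each action of x_i, but the first one makes it s, and an x_j in between moves it only
      to 0.\<close>
    then show ?thesis
      by (cases s) (auto simp: serre evals occ_swp)
  next
    case far
    then have "cartan_entry i j = 0" "cartan_entry j i = 0" "i \<noteq> j - 1" "j \<noteq> i - 1"
      by (auto simp: cartan_entry_def)
    then show ?thesis
      using swp_commute[OF far(2), of T] by (simp add: far evals occ_swp spec_swp mult_ac)
  qed
qed

section \<open>The currents of the two modules\<close>

lemma value_at_Fract:
  assumes "poly d y \<noteq> 0"
  shows "value_at (Fract n d) y = poly n y / poly d y"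
  unfolding value_at_def
proof (rule the_equality)
  fix v assume "\<exists>n' d'. Fract n d = Fract n' d' \<and> poly d' y \<noteq> 0 \<and> v = poly n' y / poly d' y"
  then obtain n' d' where *: "Fract n d = Fract n' d'" "poly d' y \<noteq> 0" "v = poly n' y / poly d' y"
    by blast
  then have "n * d' = n' * d"
    using assms by (subst (asm) eq_fract) auto
  then have "poly n y * poly d' y = poly n' y * poly d y"
    by (metis poly_mult)
  then have "poly n y / poly d y = poly n' y / poly d' y"
    using *(2) assms by (simp only: frac_eq_eq simp_thms)
  then show "v = poly n y / poly d y"
    by (simp only: *(3))
qed (use assms in blast)

lemma regular_at_Fract: "poly d y \<noteq> 0 \<Longrightarrow> regular_at (Fract n d) y"
  by (auto simp: regular_at_def)

lemma value_at_1 [simp]: "value_at 1 y = 1"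
  using value_at_Fract[of 1 y 1] by (simp add: One_fract_def)

lemma regular_at_1 [simp]: "regular_at 1 y"
  using regular_at_Fract[of 1 y 1] by (simp add: One_fract_def)

lemma psi_neq_0 [simp]: "psi t c \<noteq> 0"
  by (simp add: psi_def Zero_fract_def eq_fract)

lemma inverse_psi: "inverse (psi t c) = Fract [:1, - c:] [:exp t, - (inverse (exp t) * c):]"
  by (simp add: psi_def)

lemma qdiff_neq_0D:
  assumes "qdiff t \<noteq> 0"
  shows "exp t * exp t \<noteq> 1"
proof
  assume "exp t * exp t = 1"
  then have "exp t = inverse (exp t)"
    by (metis inverse_unique)
  then show False
    using assms by (simp add: qdiff_eq)
qed

text \<open>The argument of psi is q^2, its zero, and differs from its pole 1. This removes the
  summand of x_i^+ with a repeated entry.\<close>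

lemma psi_zero:
  assumes "c \<noteq> 0" "qdiff t \<noteq> 0"
  shows "regular_at (psi t (exp t * exp t * c)) (inverse c)"
    and "value_at (psi t (exp t * exp t * c)) (inverse c) = 0"
proof -
  have eq: "poly [:1, - (exp t * exp t * c):] (inverse c) = 1 - exp t * exp t"
    using assms by (simp add: divide_inverse[symmetric])
  have "poly [:1, - (exp t * exp t * c):] (inverse c) \<noteq> 0"
    unfolding eq using assms qdiff_neq_0D[of t] by simp
  moreover have "poly [:exp t, - (inverse (exp t) * (exp t * exp t * c)):] (inverse c) = 0"
    using assms by (simp add: field_simps)
  ultimately show "regular_at (psi t (exp t * exp t * c)) (inverse c)"
    and "value_at (psi t (exp t * exp t * c)) (inverse c) = 0"
    by (simp_all only: psi_def qpow_1 qpow_neg_1 regular_at_Fract value_at_Fract div_0 simp_thms not_False_eq_True)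
qed

text \<open>The argument is 1, a zero of 1/psi because q - q^-1 is nonzero. This removes the summand
  of x_i^- with a repeated entry.\<close>

lemma inverse_psi_zero:
  assumes "c \<noteq> 0" "qdiff t \<noteq> 0"
  shows "regular_at (inverse (psi t c)) (inverse c)"
    and "value_at (inverse (psi t c)) (inverse c) = 0"
proof -
  have eq: "poly [:exp t, - (inverse (exp t) * c):] (inverse c) = qdiff t"
    using assms by (simp add: divide_inverse[symmetric] qdiff_eq)
  have "poly [:exp t, - (inverse (exp t) * c):] (inverse c) \<noteq> 0"
    unfolding eq using assms by simp
  then show "regular_at (inverse (psi t c)) (inverse c)"
    and "value_at (inverse (psi t c)) (inverse c) = 0"
    using assms unfolding inverse_psi by (simp_all add: regular_at_Fract value_at_Fract)
qed

text \<open>The factor q^2 in the case -1 moves the pole of 1/psi to y z = 1, so that all three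
  cases equal (q^n - q^-n y z) / (1 - y z).\<close>

definition weight_fun :: "complex \<Rightarrow> int \<Rightarrow> complex \<Rightarrow> ratfun" where
  "weight_fun t n y = (if n = 1 then psi t y
     else if n = - 1 then inverse (psi t (exp t * exp t * y)) else 1)"

lemma weight_fun_eq:
  assumes "n \<in> {- 1, 0, 1}"
  shows "weight_fun t n y =
    Fract [:qpow t (of_int n), - (qpow t (of_int (- n)) * y):] [:1, - y:]"
proof -
  consider "n = 1" | "n = 0" | "n = - 1" using assms by auto
  then show ?thesis
  proof cases
    case 3
    have "inverse (psi t (exp t * exp t * y)) = Fract [:inverse (exp t), - (exp t * y):] [:1, - y:]"
      unfolding inverse_psi by (subst eq_fract) (auto simp: field_simps)
    then show ?thesis
      using 3 by (simp add: weight_fun_def)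
  qed (simp_all add: weight_fun_def psi_def One_fract_def eq_fract)
qed

text \<open>Clearing the denominator 1 - y z, coefficient by coefficient and for both directions of
  expansion.\<close>

lemma phi_coeff_rec:
  assumes n: "n \<in> {- 1, 0, 1}" and y: "y \<noteq> 0"
  shows "phi_coeff t s n y k - y * phi_coeff t s n y (k - 1) =
    (if k = 0 then qpow t (of_int n) else if k = 1 then - (qpow t (of_int (- n)) * y) else 0)"
proof -
  define u where "u = exp t"
  have u: "u \<noteq> 0"
    by (simp add: u_def)
  have n: "n = - 1 \<or> n = 0 \<or> n = 1"
    using n by auto
  consider "k = 0" | "k = 1" | "k < 0 \<or> k > 1" by linarith
  then show ?thesis
  proof cases
    case 1
    then have *: "phi_coeff t s n y k = qpow t (of_int (sg s * n))"
        "phi_coeff t s n y (k - 1) = (if s = Pos then 0 else - of_int n * qdiff t / y)"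
      by (cases s; simp add: phi_coeff_def power_int_minus divide_inverse)+
    show ?thesis
      unfolding * qdiff_eq using n y u 1
      by (cases s; elim disjE) (simp_all flip: u_def)
  next
    case 2
    then have *: "phi_coeff t s n y k = (if s = Pos then of_int n * qdiff t * y else 0)"
        "phi_coeff t s n y (k - 1) = qpow t (of_int (sg s * n))"
      by (cases s; simp add: phi_coeff_def)+
    show ?thesis
      unfolding * qdiff_eq using n y u 2
      by (cases s; elim disjE) (simp_all flip: u_def, simp_all add: algebra_simps)
  next
    case 3
    then show ?thesis
      using y power_int_add[of y "k - 1" 1] by (cases s) (auto simp: phi_coeff_def)
  qed
qed

lemma expansion_weight_fun:
  assumes n: "n \<in> {- 1, 0, 1}" and y: "y \<noteq> 0"
  shows "expansion s (weight_fun t n y) (phi_coeff t s n y)"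
  unfolding expansion_def
proof (intro conjI allI impI exI)
  fix k :: int assume "sg s * k < 0"
  then show "phi_coeff t s n y k = 0"
    by (auto simp: phi_coeff_def)
next
  let ?n = "[:qpow t (of_int n), - (qpow t (of_int (- n)) * y):]" and ?d = "[:1, - y:]"
  show "?d \<noteq> 0" by simp
  show "weight_fun t n y = Fract ?n ?d"
    using n by (rule weight_fun_eq)
  fix k :: int
  have "(\<Sum>j\<le>Polynomial.degree ?d. Polynomial.coeff ?d j * phi_coeff t s n y (k - int j)) =
      phi_coeff t s n y k - y * phi_coeff t s n y (k - 1)"
    using y by simp
  also have "\<dots> = (if k \<ge> 0 then Polynomial.coeff ?n (nat k) else 0)"
  proof -
    have "nat k = Suc (Suc (nat (k - 2)))" if "k > 1"
      using that by simp
    then show ?thesis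
      unfolding phi_coeff_rec[OF n y] by (auto simp: coeff_pCons split: nat.split)
  qed
  finally show "(\<Sum>j\<le>Polynomial.degree ?d. Polynomial.coeff ?d j * phi_coeff t s n y (k - int j)) =
      (if k \<ge> 0 then Polynomial.coeff ?n (nat k) else 0)" .
qed

section \<open>The fusion product, one tensor factor at a time\<close>

lemma fusion_params_Suc:
  "fusion_params t (Suc l) a = a # fusion_params t l (a * qpow t (- 2))"
proof -
  have "qpow t (- 2 * of_nat (Suc k)) = qpow t (- 2) * qpow t (- 2 * of_nat k)" for k
    by (simp flip: qpow_add)
  then show ?thesis
    by (simp add: fusion_params_def upt_conv_Cons map_Suc_upt[symmetric] mult.assoc del: upt_Suc)
qed

lemma rank_Cons:
  assumes "j \<notin> set T"
  shows "rank i (j # T) = of_bool (j \<le> i + 1) + rank i T"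
proof -
  have "{x \<in> set (j # T). x \<le> i + 1} = (if j \<le> i + 1 then {j} else {}) \<union> {x \<in> set T. x \<le> i + 1}"
    by auto
  then show ?thesis
    using assms by (simp add: rank_def)
qed

lemma rank_eq_of_bool:
  assumes "\<And>x. x \<in> set T \<Longrightarrow> i < x"
  shows "rank i T = of_bool (i + 1 \<in> set T)"
proof -
  have "x \<le> i + 1 \<longleftrightarrow> x = i + 1" if "x \<in> set T" for x
    using assms[OF that] by auto
  then have "{x \<in> set T. x \<le> i + 1} = (if i + 1 \<in> set T then {i + 1} else {})"
    by auto
  then show ?thesis
    by (simp add: rank_def)
qed

text \<open>The new entry raises the rank by one, which costs a factor q^-2, the ratio of
  consecutive parameters of the fusion product. Inductions over the factors therefore pass from a to
  a q^-2.\<close>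

lemma spec_Cons:
  assumes "j \<notin> set T" "j \<le> i + 1"
  shows "spec t a i (j # T) = spec t (a * qpow t (- 2)) i T"
proof -
  have "i + 2 - 2 * int (rank i (j # T)) = - 2 + (i + 2 - 2 * int (rank i T))"
    using assms by (simp add: rank_Cons)
  then show ?thesis
    by (simp only: spec_def qpow_of_int_add mult.assoc) simp
qed

lemma qpow_2: "qpow t 2 = exp t * exp t"
  using qpow_add[of t 1 1] by simp

lemma spec_lower:
  assumes "\<And>x. x \<in> set T \<Longrightarrow> i < x" "i + 1 \<in> set T"
  shows "spec t a i T = a * qpow t (of_int i)"
  using assms rank_eq_of_bool[of T i] by (simp add: spec_def)

lemma qpow_of_int_shift: "exp t * (exp t * (a * qpow t (- 2) * qpow t r)) = a * qpow t r"
proof -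
  have "exp t * (exp t * qpow t (- 2)) = 1"
    using qpow_add[of t 2 "- 2"] by (simp add: qpow_2 mult.assoc)
  then show ?thesis
    by (metis (no_types, opaque_lifting) mult.assoc mult.commute mult.left_neutral)
qed

lemma fusion_phi_eq:
  assumes "sorted_wrt (<) T"
  shows "fusion_phi t (fusion_params t (length T) a) i T = weight_fun t (occ i T) (spec t a i T)"
  using assms
proof (induction T arbitrary: a)
  case Nil
  then show ?case by (simp add: weight_fun_def occ_def)
next
  case (Cons j T)
  let ?a = "a * qpow t (- 2)"
  have T: "\<And>x. x \<in> set T \<Longrightarrow> j < x" "j \<notin> set T" using Cons.prems by auto
  have IH: "fusion_phi t (fusion_params t (length T) ?a) i T = weight_fun t (occ i T) (spec t ?a i T)"
    using Cons by simp
  consider "j < i" | "j = i" | "j = i + 1" | "j > i + 1" by linarith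
  then show ?case
  proof cases
    case 1
    then show ?thesis
      using T IH by (simp add: fusion_params_Suc box_phi_def spec_Cons) (simp add: occ_def)
  next
    case 2
    show ?thesis
    proof (cases "i + 1 \<in> set T")
      case True
      \<comment> \<open>Every entry of \<open>T\<close> exceeds \<open>i\<close>, so
        \<open>i + 1\<close> has rank 1. Then q^2 times this parameter is a q^i, and the psi of the
        head cancels the inverse psi of the tail.\<close>
      then have "spec t ?a i T = ?a * qpow t (of_int i)"
        using T 2 by (intro spec_lower) auto
      then show ?thesis
        using 2 T True IH by (simp add: fusion_params_Suc box_phi_def occ_def weight_fun_def
            qpow_of_int_shift mult.assoc[of "exp t"])
    next
      case False
      have "rank i (j # T) = 1"
        using 2 T False by (simp add: rank_Cons rank_eq_of_bool)
      then show ?thesis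
        using 2 T False IH
        by (simp add: fusion_params_Suc box_phi_def occ_def weight_fun_def) (simp add: spec_def)
    qed
  next
    case 3
    have i: "i \<notin> set T" using T(1)[of i] 3 by auto
    have "spec t a i (j # T) = a * qpow t (of_int i)"
      using 3 T(1) by (intro spec_lower) force+
    moreover have "qpow t (of_int (j + 1)) = exp t * exp t * qpow t (of_int i)"
      using qpow_of_int_add[of t 2 i] 3 by (simp add: qpow_2 add.commute)
    ultimately show ?thesis
      using 3 i T IH by (simp add: fusion_params_Suc box_phi_def occ_def weight_fun_def mult_ac)
  next
    case 4
    then have "i \<notin> set T" "i + 1 \<notin> set T"
      using T(1)[of i] T(1)[of "i + 1"] by auto
    then show ?thesis
      using 4 IH by (simp add: fusion_params_Suc box_phi_def occ_def weight_fun_def)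
  qed
qed

lemma fusion_x_Pos_Nil: "i + 1 \<notin> set T \<Longrightarrow> fusion_x t as Pos i T = []"
proof (induction T arbitrary: as)
  case (Cons j T)
  then show ?case by (cases as) auto
qed simp

lemma fusion_x_Neg_Nil: "i \<notin> set T \<Longrightarrow> fusion_x t as Neg i T = []"
proof (induction T arbitrary: as)
  case (Cons j T)
  then show ?case by (cases as) auto
qed simp

lemmas fusion_x_Nil = fusion_x_Pos_Nil fusion_x_Neg_Nil

text \<open>Only the factor \<open>i + 1\<close> is raised. The coproduct multiplies by phi_i of the
  factors to its left, of which only a factor \<open>i\<close> contributes.\<close>

lemma fusion_x_Pos:
  assumes "sorted_wrt (<) T" "i + 1 \<in> set T"
  shows "fusion_x t (fusion_params t (length T) a) Pos i T =
    [(if i \<in> set T then psi t (exp t * exp t * spec t a i T) else 1, spec t a i T,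
      map (\<lambda>x. if x = i + 1 then i else x) T)]"
  using assms
proof (induction T arbitrary: a)
  case Nil
  then show ?case by simp
next
  case (Cons j T)
  let ?a = "a * qpow t (- 2)"
  have T: "\<And>x. x \<in> set T \<Longrightarrow> j < x" "j \<notin> set T" using Cons.prems by auto
  show ?case
  proof (cases "j = i + 1")
    case True
    have "i + 1 \<notin> set T" "i \<notin> set T" using T(1)[of i] T(2) True by auto
    moreover from this have "map (\<lambda>x. if x = i + 1 then i else x) T = T"
      by (intro map_idI) auto
    moreover have "spec t a i (j # T) = a * qpow t (of_int i)"
      using True T(1) by (intro spec_lower) force+
    ultimately show ?thesis
      using True by (simp add: fusion_params_Suc fusion_x_Nil)
  next
    case False
    then have i: "i + 1 \<in> set T" using Cons.prems by auto
    with T have j: "j \<le> i" by force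
    have IH: "fusion_x t (fusion_params t (length T) ?a) Pos i T =
      [(if i \<in> set T then psi t (exp t * exp t * spec t ?a i T) else 1, spec t ?a i T,
      map (\<lambda>x. if x = i + 1 then i else x) T)]"
      using Cons i by simp
    show ?thesis
    proof (cases "j = i")
      case True
      then have "spec t ?a i T = ?a * qpow t (of_int i)"
        using T i by (intro spec_lower) auto
      then show ?thesis
        using True T j IH
        by (simp add: fusion_params_Suc box_phi_def spec_Cons qpow_of_int_shift mult.assoc[of "exp t"])
    next
      case neq: False
      then show ?thesis
        using False T j IH by (simp add: fusion_params_Suc box_phi_def spec_Cons)
    qed
  qed
qed

text \<open>Here phi_i comes from the factors on the right, of which only \<open>i + 1\<close>
  contributes. Since \<open>rank\<close> counts that entry too, the position of \<open>i\<close> is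
  then one less and its parameter is q^2 times \<open>spec\<close>.\<close>

lemma fusion_x_Neg:
  assumes "sorted_wrt (<) T" "i \<in> set T"
  shows "fusion_x t (fusion_params t (length T) a) Neg i T =
    (let c = (if i + 1 \<in> set T then exp t * exp t * spec t a i T else spec t a i T)
     in [(if i + 1 \<in> set T then inverse (psi t c) else 1, c,
          map (\<lambda>x. if x = i then i + 1 else x) T)])"
  using assms
proof (induction T arbitrary: a)
  case Nil
  then show ?case by simp
next
  case (Cons j T)
  let ?a = "a * qpow t (- 2)"
  have T: "\<And>x. x \<in> set T \<Longrightarrow> j < x" "j \<notin> set T" "sorted_wrt (<) T" using Cons.prems by auto
  show ?case
  proof (cases "j = i")
    case True
    have i: "i \<notin> set T" using T(2) True by auto
    then have map: "map (\<lambda>x. if x = i then i + 1 else x) T = T"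
      by (intro map_idI) auto
    show ?thesis
    proof (cases "i + 1 \<in> set T")
      case i1: True
      then have "spec t ?a i T = ?a * qpow t (of_int i)"
        using T True by (intro spec_lower) auto
      then have "exp t * exp t * spec t ?a i T = a * qpow t (of_int i)"
        by (simp add: qpow_of_int_shift mult.assoc[of "exp t"])
      moreover from this have "fusion_phi t (fusion_params t (length T) ?a) i T =
          inverse (psi t (a * qpow t (of_int i)))"
        using i i1 fusion_phi_eq[OF T(3), of t ?a i] by (simp add: occ_def weight_fun_def)
      ultimately show ?thesis
        using True T(2) i i1 map by (simp add: fusion_params_Suc fusion_x_Nil spec_Cons Let_def)
    next
      case False
      have "rank i (j # T) = 1"
        using True T False by (simp add: rank_Cons rank_eq_of_bool)
      then have "spec t a i (j # T) = a * qpow t (of_int i)"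
        by (simp add: spec_def)
      moreover have "fusion_phi t (fusion_params t (length T) ?a) i T = 1"
        using i False fusion_phi_eq[OF T(3), of t ?a i] by (simp add: occ_def weight_fun_def)
      ultimately show ?thesis
        using True i False map by (simp add: fusion_params_Suc fusion_x_Nil Let_def)
    qed
  next
    case False
    then have i: "i \<in> set T" using Cons.prems by auto
    with T have j: "j < i" by force
    show ?thesis
      using False T(2,3) j i Cons.IH[of ?a] by (simp add: fusion_params_Suc spec_Cons Let_def)
  qed
qed

lemma map_shift_eq_swp:
  "i \<notin> set T \<Longrightarrow> map (\<lambda>x. if x = i + 1 then i else x) T = swp i T"
  "i + 1 \<notin> set T \<Longrightarrow> map (\<lambda>x. if x = i then i + 1 else x) T = swp i T"
  by (auto simp: swp_def Transposition.transpose_def)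

text \<open>Only one of the two values occurs, and no integer lies strictly between them, so no
  entry is overtaken.\<close>

lemma sorted_wrt_swp:
  assumes "sorted_wrt (<) T" "occ i T \<noteq> 0"
  shows "sorted_wrt (<) (swp i T)"
proof -
  have "Transposition.transpose i (i + 1) x < Transposition.transpose i (i + 1) y"
    if "x \<in> set T" "y \<in> set T" "x < y" for x y
    using assms(2) that by (auto simp: Transposition.transpose_def occ_def split: if_splits)
  with assms(1) show ?thesis
    unfolding swp_def sorted_wrt_map by (auto intro: sorted_wrt_mono_rel[rotated])
qed

text \<open>The common structure constants to which the currents of both modules are
  reduced.\<close>

definition reduced_coeff :: "complex \<Rightarrow> complex \<Rightarrow> sign \<Rightarrow> int \<Rightarrow> int list \<Rightarrow> int \<Rightarrow> (int list \<Rightarrow>\<^sub>0 complex)" where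
  "reduced_coeff t a s i T r =
     (if occ i T = - sg s then Poly_Mapping.single (swp i T) (spec t a i T powi r) else 0)"

text \<open>If \<open>i\<close> and \<open>i + 1\<close> both occur, the list still holds one term;
  it is regular, but its coefficient is 0, in agreement with \<open>occ i T = 0\<close>.\<close>

lemma fusion_current:
  assumes T: "T \<in> tableaux l" and a: "a \<noteq> 0" and q: "qdiff t \<noteq> 0"
  shows "current_regular (fusion_x t (fusion_params t l a) s i T)"
    and "current_coeff (fusion_x t (fusion_params t l a) s i T) r = reduced_coeff t a s i T r"
proof -
  have T: "sorted_wrt (<) T" "l = length T" using T by (auto simp: tableaux_def)
  have c: "spec t a i T \<noteq> 0" using a by simp
  have c': "exp t * exp t * spec t a i T \<noteq> 0" using a by simp
  have "current_regular (fusion_x t (fusion_params t l a) s i T) \<and>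
    current_coeff (fusion_x t (fusion_params t l a) s i T) r = reduced_coeff t a s i T r"
  proof (cases s)
    case Pos
    consider "i + 1 \<notin> set T" | "i + 1 \<in> set T" "i \<in> set T" | "i + 1 \<in> set T" "i \<notin> set T" by blast
    then show ?thesis
      using Pos T a c psi_zero[OF c q]
      by cases (auto simp: fusion_x_Nil fusion_x_Pos current_regular_def current_coeff_def
          reduced_coeff_def occ_def map_shift_eq_swp vscale_bvec)
  next
    case Neg
    consider "i \<notin> set T" | "i + 1 \<in> set T" "i \<in> set T" | "i + 1 \<notin> set T" "i \<in> set T" by blast
    then show ?thesis
      using Neg T a c c' inverse_psi_zero[OF c' q]
      by cases (auto simp: fusion_x_Nil fusion_x_Neg current_regular_def current_coeff_def
          reduced_coeff_def occ_def map_shift_eq_swp vscale_bvec Let_def)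
  qed
  then show "current_regular (fusion_x t (fusion_params t l a) s i T)"
    and "current_coeff (fusion_x t (fusion_params t l a) s i T) r = reduced_coeff t a s i T r"
    by auto
qed

section \<open>Positions in a column and the extremal module\<close>

lemma card_le_nth_sorted:
  fixes T :: "int list"
  assumes "sorted_wrt (<) T" "k < length T"
  shows "card {x \<in> set T. x \<le> T ! k} = Suc k"
proof -
  have "{x \<in> set T. x \<le> T ! k} = (!) T ` {..k}"
  proof (intro equalityI subsetI)
    fix x assume "x \<in> {x \<in> set T. x \<le> T ! k}"
    then obtain m where "m < length T" "x = T ! m" "T ! m \<le> T ! k"
      by (auto simp: in_set_conv_nth)
    then show "x \<in> (!) T ` {..k}"
      using sorted_wrt_nth_less[OF assms(1), of k m] by force
  next
    fix x assume "x \<in> (!) T ` {..k}"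
    then obtain m where "m \<le> k" "x = T ! m" by auto
    then show "x \<in> {x \<in> set T. x \<le> T ! k}"
      using sorted_wrt_nth_less[OF assms(1), of m k] assms(2) by (cases "m = k") auto
  qed
  moreover have "inj_on ((!) T) {..k}"
    using assms by (intro inj_on_nth) (auto simp: strict_sorted_iff)
  ultimately show ?thesis
    by (simp add: card_image)
qed

lemma entry_eq_iff_card:
  assumes "T \<in> tableaux l" "x \<in> set T"
  shows "card {y \<in> set T. y \<le> x} \<in> {1..l}"
    and "p \<in> {1..l} \<Longrightarrow> entry T p = x \<longleftrightarrow> p = card {y \<in> set T. y \<le> x}"
proof -
  have T: "sorted_wrt (<) T" "l = length T" using assms by (auto simp: tableaux_def)
  obtain k where k: "k < l" "x = T ! k" using assms(2) T by (auto simp: in_set_conv_nth)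
  have distinct: "distinct T" using T by (simp add: strict_sorted_iff)
  show "card {y \<in> set T. y \<le> x} \<in> {1..l}"
    using k T card_le_nth_sorted[of T k] by auto
  assume "p \<in> {1..l}"
  then show "entry T p = x \<longleftrightarrow> p = card {y \<in> set T. y \<le> x}"
    using k T card_le_nth_sorted[of T k] distinct
    by (auto simp: entry_def nth_eq_iff_index_eq)
qed

lemma card_le_eq_rank:
  "card {y \<in> set T. y \<le> i + 1} = rank i T"
  "i + 1 \<notin> set T \<Longrightarrow> card {y \<in> set T. y \<le> i} = rank i T"
proof -
  assume "i + 1 \<notin> set T"
  then have "y \<le> i \<longleftrightarrow> y \<le> i + 1" if "y \<in> set T" for y
    using that by (cases "y = i + 1") auto
  then have "{y \<in> set T. y \<le> i} = {y \<in> set T. y \<le> i + 1}" by auto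
  then show "card {y \<in> set T. y \<le> i} = rank i T" by (simp add: rank_def)
qed (simp add: rank_def)

lemma position_eq:
  assumes "T \<in> tableaux l" "x \<in> set T"
  shows "position T x = card {y \<in> set T. y \<le> x}"
proof -
  have "l = length T" using assms by (simp add: tableaux_def)
  then show ?thesis
    unfolding position_def using entry_eq_iff_card[OF assms]
    by (intro the_equality) auto
qed

text \<open>Evaluates the comprehensions in \<open>ext_x\<close>, whose condition is met by one
  position only.\<close>

lemma concat_map_single:
  assumes "distinct xs" "x \<in> set xs" "\<And>y. y \<in> set xs \<Longrightarrow> P y \<longleftrightarrow> y = x"
  shows "concat (map (\<lambda>y. if P y then [f y] else []) xs) = [f x]"
proof -
  have "concat (map (\<lambda>y. if P y then [f y] else []) xs) = concat (map (\<lambda>y. if y = x then [f y] else []) xs)"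
    using assms(3) by (intro arg_cong[of _ _ concat] map_cong) auto
  also have "\<dots> = [f x]"
    using assms(1,2)
  proof (induction xs)
    case (Cons y ys)
    have "concat (map (\<lambda>y. if y = x then [f y] else []) ys) = []" if "x \<notin> set ys"
      using that by auto
    then show ?case using Cons by auto
  qed simp
  finally show ?thesis .
qed

lemma spec_eq_ext_param:
  "a * qpow t (1 - of_nat l) * qpow t (of_int (i + int l + 1 - 2 * int (rank i T))) = spec t a i T"
proof -
  have "i + 2 - 2 * int (rank i T) = (1 - int l) + (i + int l + 1 - 2 * int (rank i T))"
    by simp
  then show ?thesis
    by (simp only: spec_def qpow_of_int_add mult.assoc) simp
qed

lemma ext_x_eq:
  assumes T: "T \<in> tableaux l"
  shows "ext_x t l (a * qpow t (1 - of_nat l)) s i T =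
    (if occ i T = - sg s then [(1, spec t a i T, swp i T)] else [])"
proof (cases s)
  case Pos
  show ?thesis
  proof (cases "i + 1 \<in> set T \<and> i \<notin> set T")
    case True
    note x = entry_eq_iff_card[OF T, of "i + 1", unfolded card_le_eq_rank(1)]
    have "concat (map (\<lambda>p. if entry T p = i + 1 then [g p] else []) [1..<l + 1]) = [g (rank i T)]"
      for g :: "nat \<Rightarrow> ratfun \<times> complex \<times> int list"
    proof (rule concat_map_single)
      show "rank i T \<in> set [1..<l + 1]"
        using x(1) True by auto
      show "entry T p = i + 1 \<longleftrightarrow> p = rank i T" if "p \<in> set [1..<l + 1]" for p
        using x(2)[of p] True that by auto
    qed simp
    moreover have "e_tab i T = Some (swp i T)" "occ i T = - sg s"
      using True Pos by (simp_all add: e_tab_def map_shift_eq_swp occ_def)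
    ultimately show ?thesis
      by (simp only: Pos ext_x.simps option.case spec_eq_ext_param if_True simp_thms)
  qed (use Pos in \<open>auto simp: e_tab_def occ_def\<close>)
next
  case Neg
  show ?thesis
  proof (cases "i \<in> set T \<and> i + 1 \<notin> set T")
    case True
    note x = entry_eq_iff_card[OF T, of i]
    have rank: "card {y \<in> set T. y \<le> i} = rank i T"
      using True by (simp add: card_le_eq_rank)
    have "concat (map (\<lambda>p. if entry T p = i then [g p] else []) [1..<l + 1]) = [g (rank i T)]"
      for g :: "nat \<Rightarrow> ratfun \<times> complex \<times> int list"
    proof (rule concat_map_single)
      show "rank i T \<in> set [1..<l + 1]"
        using x(1) True rank by auto
      show "entry T p = i \<longleftrightarrow> p = rank i T" if "p \<in> set [1..<l + 1]" for p
        using x(2)[of p] True that rank by auto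
    qed simp
    moreover have "f_tab i T = Some (swp i T)" "occ i T = - sg s"
      using True Neg by (simp_all add: f_tab_def map_shift_eq_swp occ_def)
    ultimately show ?thesis
      by (simp only: Neg ext_x.simps option.case spec_eq_ext_param if_True simp_thms)
  qed (use Neg in \<open>auto simp: f_tab_def occ_def\<close>)
qed

lemma ext_current:
  assumes T: "T \<in> tableaux l" and a: "a \<noteq> 0"
  shows "current_regular (ext_x t l (a * qpow t (1 - of_nat l)) s i T)"
    and "current_coeff (ext_x t l (a * qpow t (1 - of_nat l)) s i T) r = reduced_coeff t a s i T r"
  using a by (auto simp: ext_x_eq[OF T] current_regular_def current_coeff_def reduced_coeff_def
      vscale_bvec)

lemma ext_phi_eq:
  assumes T: "T \<in> tableaux l"
  shows "ext_phi t l (a * qpow t (1 - of_nat l)) i T = weight_fun t (occ i T) (spec t a i T)"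
proof -
  have "a * qpow t (1 - of_nat l) * qpow t (of_int (i + int l + 3 - 2 * int (rank i T))) =
      exp t * exp t * spec t a i T"
  proof -
    have "i + int l + 3 - 2 * int (rank i T) = 2 + (i + int l + 1 - 2 * int (rank i T))" by simp
    then show ?thesis
      unfolding spec_eq_ext_param[of a t l i T, symmetric]
      by (simp only: qpow_of_int_add) (simp add: qpow_2)
  qed
  then show ?thesis
    unfolding ext_phi_def
    using position_eq[OF T, of "i + 1"] position_eq[OF T, of i] spec_eq_ext_param[of a t l i T]
    by (auto simp: card_le_eq_rank weight_fun_def occ_def)
qed

lemma fusion_k_eq:
  assumes "distinct T"
  shows "fusion_k t h T = ext_k t h T"
  using assms by (induction T) (auto simp: box_k_def ext_k_def qpow_add)

section \<open>Uniqueness of the action\<close>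

text \<open>The product of a polynomial with a two-sided formal series. Such series have no product
  among themselves but form a module over the polynomials.\<close>

definition poly_act :: "complex poly \<Rightarrow> (int \<Rightarrow> complex) \<Rightarrow> int \<Rightarrow> complex" where
  "poly_act p e k = (\<Sum>j\<le>Polynomial.degree p. Polynomial.coeff p j * e (k - int j))"

lemma poly_act_ge:
  assumes "Polynomial.degree p \<le> N"
  shows "poly_act p e k = (\<Sum>j\<le>N. Polynomial.coeff p j * e (k - int j))"
  unfolding poly_act_def using assms
  by (intro sum.mono_neutral_left) (auto simp: coeff_eq_0)

lemma poly_act_add: "poly_act (p + p') e k = poly_act p e k + poly_act p' e k"
proof -
  let ?N = "max (Polynomial.degree p) (Polynomial.degree p')"
  have "poly_act u e k = (\<Sum>j\<le>?N. Polynomial.coeff u j * e (k - int j))" if "u \<in> {p, p', p + p'}" for u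
    using that degree_add_le_max[of p p'] by (intro poly_act_ge) auto
  then show ?thesis
    by (simp add: sum.distrib distrib_right)
qed

lemma poly_act_smult: "poly_act (smult c p) e k = c * poly_act p e k"
  by (subst poly_act_ge[of _ "Polynomial.degree p"]) (auto simp: poly_act_def sum_distrib_left mult_ac degree_smult_le)

lemma poly_act_pCons: "poly_act (pCons c p) e k = c * e k + poly_act p e (k - 1)"
  by (subst poly_act_ge[of _ "Suc (Polynomial.degree p)"], simp add: degree_pCons_le)
     (simp add: sum.atMost_Suc_shift poly_act_def diff_diff_eq add.commute del: sum.atMost_Suc)

lemma poly_act_mult: "poly_act (p * p') e k = poly_act p (poly_act p' e) k"
proof (induction p arbitrary: k)
  case 0
  then show ?case by (simp add: poly_act_def)
next
  case (pCons c p)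
  then show ?case
    by (simp add: poly_act_add poly_act_smult poly_act_pCons)
qed

lemma poly_act_delta:
  "poly_act p (\<lambda>k. of_bool (k = 0)) k = (if k \<ge> 0 then Polynomial.coeff p (nat k) else 0)"
proof (induction p arbitrary: k)
  case 0
  then show ?case by (simp add: poly_act_def)
next
  case (pCons c p)
  have "nat k = Suc (nat (k - 1))" if "k > 0" using that by simp
  then show ?case
    using pCons by (auto simp: poly_act_pCons coeff_pCons split: nat.split)
qed

lemma expansion_iff:
  "expansion s f e \<longleftrightarrow> (\<forall>k. sg s * k < 0 \<longrightarrow> e k = 0) \<and>
    (\<exists>n d. d \<noteq> 0 \<and> f = Fract n d \<and> poly_act d e = poly_act n (\<lambda>k. of_bool (k = 0)))"
  by (simp add: expansion_def fun_eq_iff poly_act_delta) (simp add: poly_act_def)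

text \<open>A polynomial acts injectively on series that extend in one direction only: its extremal
  coefficient, at \<open>m\<close>, determines the values of \<open>e\<close> one after another,
  moving away from 0.\<close>

lemma poly_act_eq_0D:
  assumes zero: "\<And>k. poly_act p e k = 0" and bound: "\<And>k. sg s * k < 0 \<Longrightarrow> e k = 0"
    and m: "Polynomial.coeff p m \<noteq> 0"
      "\<And>j. Polynomial.coeff p j \<noteq> 0 \<Longrightarrow> j \<noteq> m \<Longrightarrow> sg s * (int m - int j) < 0"
  shows "e k = 0"
proof -
  have s: "sg s * (sg s * x) = x" for x by (cases s) auto
  have "e (sg s * int n) = 0" for n
  proof (induction n rule: less_induct)
    case (less n)
    have vanish: "Polynomial.coeff p j * e (sg s * int n + int m - int j) = 0" if "j \<noteq> m" for j
    proof (cases "Polynomial.coeff p j = 0")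
      case False
      let ?x = "sg s * int n + int m - int j"
      have "sg s * ?x = int n + sg s * (int m - int j)"
        by (cases s) auto
      then have lt: "sg s * ?x < int n"
        using m(2)[OF False that] by simp
      have "e x = 0" if "sg s * x < int n" for x
      proof (cases "sg s * x < 0")
        case False
        then have eq: "sg s * int (nat (sg s * x)) = x"
          by (simp add: s)
        then show ?thesis
          using less[of "nat (sg s * x)", unfolded eq] that False by simp
      qed (rule bound)
      from this[OF lt] show ?thesis
        by simp
    qed simp
    have "poly_act p e (sg s * int n + int m) =
        (\<Sum>j\<le>Polynomial.degree p. if j = m then Polynomial.coeff p m * e (sg s * int n) else 0)"
      unfolding poly_act_def using vanish by (intro sum.cong) auto
    also have "\<dots> = Polynomial.coeff p m * e (sg s * int n)"
      using le_degree[OF m(1)] by simp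
    finally show ?case
      using zero m(1) by simp
  qed
  from this[of "nat (sg s * k)"] bound[of k] show ?thesis
    by (cases "sg s * k < 0") (auto simp: s)
qed

text \<open>The two expansions may use different fractions for \<open>f\<close>. Cross-multiplying,
  the product of the denominators annihilates their difference.\<close>

lemma expansion_unique:
  assumes "expansion s f e" "expansion s f e'"
  shows "e = e'"
proof
  fix k
  let ?\<delta> = "\<lambda>k :: int. of_bool (k = 0) :: complex"
  obtain n d where d: "d \<noteq> 0" "f = Fract n d" "poly_act d e = poly_act n ?\<delta>"
    using assms(1) unfolding expansion_iff by blast
  obtain n' d' where d': "d' \<noteq> 0" "f = Fract n' d'" "poly_act d' e' = poly_act n' ?\<delta>"
    using assms(2) unfolding expansion_iff by blast
  have "Fract n d = Fract n' d'"
    using d(2) d'(2) by (rule subst)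
  then have cross: "d' * n = d * n'"
    using d(1) d'(1) by (simp only: eq_fract simp_thms mult.commute)
  define D where "D = d * d'"
  have "poly_act D e = poly_act D e'"
  proof
    fix k
    have "poly_act D e k = poly_act d' (poly_act d e) k"
      unfolding D_def by (subst mult.commute) (rule poly_act_mult)
    also have "\<dots> = poly_act (d' * n) ?\<delta> k"
      by (simp only: d(3) poly_act_mult)
    also have "\<dots> = poly_act D e' k"
      by (simp only: cross D_def d'(3) poly_act_mult)
    finally show "poly_act D e k = poly_act D e' k" .
  qed
  moreover have "poly_act D (\<lambda>k. e k - e' k) k = poly_act D e k - poly_act D e' k" for k
    by (simp only: poly_act_def right_diff_distrib sum_subtractf)
  ultimately have zero: "poly_act D (\<lambda>k. e k - e' k) k = 0" for k
    by simp
  have bound: "e k - e' k = 0" if "sg s * k < 0" for k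
    using assms[unfolded expansion_def, THEN conjunct1] that by simp
  have D: "D \<noteq> 0"
    using d(1) d'(1) by (simp add: D_def)
  \<comment> \<open>The lowest coefficient serves for expansions in z, the leading one for
    expansions in 1/z.\<close>
  obtain m where m: "Polynomial.coeff D m \<noteq> 0"
    "\<And>j. Polynomial.coeff D j \<noteq> 0 \<Longrightarrow> j \<noteq> m \<Longrightarrow> sg s * (int m - int j) < 0"
  proof (cases s)
    case Pos
    define m where "m = (LEAST j. Polynomial.coeff D j \<noteq> 0)"
    have "Polynomial.coeff D m \<noteq> 0"
      unfolding m_def by (rule LeastI[of _ "Polynomial.degree D"]) (simp add: D)
    moreover have "m \<le> j" if "Polynomial.coeff D j \<noteq> 0" for j
      unfolding m_def using that by (rule Least_le)
    ultimately show ?thesis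
      by (intro that[of m]) (auto simp: Pos le_neq_implies_less)
  next
    case Neg
    show ?thesis
    proof (rule that[of "Polynomial.degree D"])
      fix j assume "Polynomial.coeff D j \<noteq> 0" "j \<noteq> Polynomial.degree D"
      then show "sg s * (int (Polynomial.degree D) - int j) < 0"
        using le_degree[of D j] by (simp add: Neg)
    qed (use D in \<open>simp\<close>)
  qed
  have "e k - e' k = 0"
    using zero bound m by (rule poly_act_eq_0D)
  then show "e k = e' k"
    by simp
qed

section \<open>Actions determined by x, k and phi\<close>

lemma scal_mult: "scal c * scal d = scal (c * d)"
  by (simp add: scal_def mult_single)

lemma scal_1 [simp]: "scal 1 = 1"
  by (simp add: scal_def)

lemma scal_commute: "scal c * p = p * scal c"
  by (induction p rule: poly_mapping_single_induct)
    (simp_all add: distrib_left distrib_right, simp add: scal_def mult_single mult.commute)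

lemma free_algebra_induct [case_names scal gen add mult]:
  assumes "\<And>c. P (scal c)" "\<And>g. P (gen g)" "\<And>p p'. P p \<Longrightarrow> P p' \<Longrightarrow> P (p + p')"
    "\<And>p p'. P p \<Longrightarrow> P p' \<Longrightarrow> P (p * p')"
  shows "P p"
proof (induction p rule: poly_mapping_single_induct)
  case (single w c)
  have "P (Poly_Mapping.single (Word gs) c)" for gs
  proof (induction gs)
    case Nil
    then show ?case using assms(1)[of c] by (simp add: scal_def zero_word_def)
  next
    case (Cons g gs)
    then show ?case
      using assms(4)[OF assms(2)[of g] Cons] by (simp add: gen_def mult_single plus_word_def)
  qed
  then show ?case by (cases w) simp
qed (rule assms(3))

lemma uq_class_in_carrier: "uq_class t p \<in> carrier (Uq t)"
  by (simp add: carrier_Uq)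

context
  fixes t :: complex and V :: "('b \<Rightarrow>\<^sub>0 complex) set" and act
  assumes module: "uq_module t V act"
begin

lemma act_closed: "v \<in> V \<Longrightarrow> act (uq_class t p) v \<in> V"
  using module by (simp add: uq_module_def uq_class_in_carrier)

lemma act_add: "v \<in> V \<Longrightarrow> act (uq_class t (p + p')) v = act (uq_class t p) v + act (uq_class t p') v"
  using module by (simp add: uq_module_def uq_class_in_carrier flip: uq_class_add)

lemma act_mult: "v \<in> V \<Longrightarrow> act (uq_class t (p * p')) v = act (uq_class t p) (act (uq_class t p') v)"
  using module by (simp add: uq_module_def uq_class_in_carrier flip: uq_class_mult)

lemma act_add_right:
  "v \<in> V \<Longrightarrow> w \<in> V \<Longrightarrow> act (uq_class t p) (v + w) = act (uq_class t p) v + act (uq_class t p) w"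
  using module by (simp add: uq_module_def uq_class_in_carrier)

lemma act_scal: "v \<in> V \<Longrightarrow> act (uq_class t (scal c)) v = vscale c v"
  using module by (simp add: uq_module_def)

lemma act_vscale: "v \<in> V \<Longrightarrow> act (uq_class t p) (vscale c v) = vscale c (act (uq_class t p) v)"
  using act_mult[of v p "scal c"] act_mult[of v "scal c" p] scal_commute[of c p]
  by (simp add: act_scal act_closed)

lemma act_KGen_inverse:
  assumes "v \<in> V"
  shows "act (uq_class t (gen (KGen (- h)))) (act (uq_class t (gen (KGen h))) v) = v"
proof -
  have "gen (KGen (- h)) * gen (KGen h) - gen (KGen (- h + h)) \<in> relations t"
    unfolding relations_def by blast
  then have "uq_class t (gen (KGen (- h)) * gen (KGen h)) = uq_class t (gen (KGen 0))"
    using relations_subset_rel_ideal by (intro uq_class_eqI) auto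
  also have "gen (KGen 0) - 1 \<in> relations t"
    unfolding relations_def by blast
  then have "uq_class t (gen (KGen 0)) = uq_class t (scal 1)"
    using relations_subset_rel_ideal by (intro uq_class_eqI) auto
  finally show ?thesis
    using assms by (simp only: act_mult[symmetric] act_scal) simp
qed

end

text \<open>Without a constant term, two or more factors reach degree m + 1 only through
  coefficients of degree at most m.\<close>

lemma fps_power_in_subring:
  fixes U :: "'a :: ring_1 fps"
  assumes U: "U $ 0 = 0" "\<And>j. j \<le> m \<Longrightarrow> U $ j \<in> S"
    and S: "0 \<in> S" "1 \<in> S" "\<And>x y. x \<in> S \<Longrightarrow> y \<in> S \<Longrightarrow> x + y \<in> S" "\<And>x y. x \<in> S \<Longrightarrow> y \<in> S \<Longrightarrow> x * y \<in> S"
    and n: "n \<noteq> 1"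
  shows "U ^ n $ Suc m \<in> S"
proof -
  have sum: "sum f A \<in> S" if "\<And>x. x \<in> A \<Longrightarrow> f x \<in> S" for f :: "nat \<Rightarrow> 'a" and A
    using that by (induction A rule: infinite_finite_induct) (auto intro: S)
  have le: "U ^ n $ j \<in> S" if "j \<le> m" for n j
    using that
  proof (induction n arbitrary: j)
    case (Suc n)
    then show ?case
      by (auto simp: fps_mult_nth intro!: sum S U)
  qed (auto simp: S)
  show ?thesis
  proof (cases n)
    case 0
    then show ?thesis by (simp add: S)
  next
    case (Suc k)
    with n U have zero: "U ^ k $ 0 = 0"
      by (simp add: fps_power_zeroth power_0_left)
    have "U $ j * U ^ k $ (Suc m - j) \<in> S" if j: "j \<le> Suc m" for j
    proof -
      consider "j = 0" | "j = Suc m" | "j \<le> m" "Suc m - j \<le> m" using j by arith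
      then show ?thesis
        by cases (simp_all add: U S le zero)
    qed
    then show ?thesis
      unfolding Suc power_Suc fps_mult_nth by (intro sum) auto
  qed
qed

text \<open>The elements on which both actions agree form a subalgebra \<open>S\<close> of the free
  algebra. It contains x, k and phi by assumption, and the h_(i,m) by induction on their
  degree.\<close>

lemma uq_module_eq:
  assumes act: "uq_module t (vs.span (bvec ` B)) act" and act': "uq_module t (vs.span (bvec ` B)) act'"
    and q: "qdiff t \<noteq> 0"
    and X: "\<And>b s i r. b \<in> B \<Longrightarrow> act (uq_class t (xg s i r)) (bvec b) = act' (uq_class t (xg s i r)) (bvec b)"
    and K: "\<And>b h. b \<in> B \<Longrightarrow> act (uq_class t (gen (KGen h))) (bvec b) = act' (uq_class t (gen (KGen h))) (bvec b)"
    and phi: "\<And>b s i m. b \<in> B \<Longrightarrow> act (uq_class t (phi t s i m)) (bvec b) = act' (uq_class t (phi t s i m)) (bvec b)"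
    and v: "v \<in> vs.span (bvec ` B)"
  shows "act (uq_class t p) v = act' (uq_class t p) v"
proof -
  let ?V = "vs.span (bvec ` B)"
  define S where "S = {p. \<forall>v\<in>?V. act (uq_class t p) v = act' (uq_class t p) v}"
  have basis: "p \<in> S" if p: "\<And>b. b \<in> B \<Longrightarrow> act (uq_class t p) (bvec b) = act' (uq_class t p) (bvec b)" for p
  proof -
    have zero: "0 \<in> ?V" by (rule vs.span_zero)
    have "v \<in> ?V \<and> act (uq_class t p) v = act' (uq_class t p) v" if "v \<in> ?V" for v
      using that
    proof (induction rule: vs.span_induct_alt)
      case base
      show ?case
        using zero act_vscale[OF act zero, of p 0] act_vscale[OF act' zero, of p 0] by simp
    next
      case (step c x y)
      then obtain b where b: "b \<in> B" "x = bvec b" by auto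
      then have x: "x \<in> ?V" by (auto intro: vs.span_base)
      then have cx: "vscale c x \<in> ?V" by (rule vs.span_scale)
      show ?case
        using step(2) p[OF b(1), folded b(2)] vs.span_add[OF cx]
        by (simp add: act_add_right[OF act cx] act_add_right[OF act' cx] act_vscale[OF act x] act_vscale[OF act' x])
    qed
    then show ?thesis by (simp add: S_def)
  qed
  have add: "p + p' \<in> S" if "p \<in> S" "p' \<in> S" for p p'
    using that by (simp add: S_def act_add[OF act] act_add[OF act'])
  have mult: "p * p' \<in> S" if "p \<in> S" "p' \<in> S" for p p'
    using that by (simp add: S_def act_mult[OF act] act_mult[OF act'] act_closed[OF act'])
  have scal: "scal c \<in> S" for c
    by (simp add: S_def act_scal[OF act] act_scal[OF act'])
  have one: "1 \<in> S" and zero: "0 \<in> S"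
    using scal[of 1] scal[of 0] by (simp_all add: scal_def)
  have diff: "p - p' \<in> S" if "p \<in> S" "p' \<in> S" for p p'
  proof -
    have "p - p' = p + scal (- 1) * p'"
      by (simp add: vs.scale_minus_left flip: vscale_conv_mult)
    then show ?thesis using add mult scal that by metis
  qed
  have sum: "sum f A \<in> S" if "\<And>x. x \<in> A \<Longrightarrow> f x \<in> S" for f :: "nat \<Rightarrow> uq_free" and A
    using that by (induction A rule: infinite_finite_induct) (auto intro: add zero)
  have KS: "gen (KGen h) \<in> S" for h by (rule basis) (rule K)
  have phiS: "Defs.phi t s i k \<in> S" for s i k by (rule basis) (rule phi)
  have H: "gen (HGen s i m) \<in> S" for s i m
  proof (induction m rule: less_induct)
    case (less m)
    define c where "c = of_int (sg s) * qdiff t"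
    define h where "h = (case s of Pos \<Rightarrow> coroot i | Neg \<Rightarrow> - coroot i)"
    define U where "U = Abs_fps (\<lambda>m. if m = 0 then 0 else scal c * gen (HGen s i (m - 1)))"
    define R where "R = (\<Sum>n\<in>{..Suc m} - {1}. scal (1 / fact n) * U ^ n $ Suc m)"
    \<comment> \<open>The linear term of the exponential isolates \<open>HGen s i m\<close>, which
      sits in degree m + 1; \<open>R\<close> involves earlier generators only.\<close>
    have "fps_expo U $ Suc m = U $ Suc m + R"
      unfolding fps_expo_def R_def fps_nth_Abs_fps
      by (subst sum.remove[of _ 1]) simp_all
    moreover have "phi t s i (sg s * int (Suc m)) = gen (KGen h) * fps_expo U $ Suc m"
    proof -
      have "phi_series t s i = fps_const (gen (KGen h)) * fps_expo U"
        by (simp only: phi_series_def U_def h_def c_def)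
      moreover have eq: "sg s * (sg s * int (Suc m)) = int (Suc m)"
        by (cases s) simp_all
      ultimately show ?thesis
        unfolding phi_def eq by (simp del: of_nat_Suc)
    qed
    ultimately have "gen (KGen h) * U $ Suc m = phi t s i (sg s * int (Suc m)) - gen (KGen h) * R"
      by (simp add: distrib_left)
    moreover have "R \<in> S"
      unfolding R_def
    proof (intro sum mult scal)
      fix n assume "n \<in> {..Suc m} - {1}"
      then show "U ^ n $ Suc m \<in> S"
        using less by (intro fps_power_in_subring) (auto simp: U_def intro: add mult scal zero one)
    qed
    ultimately have KU: "gen (KGen h) * U $ Suc m \<in> S"
      by (simp only: diff mult KS phiS)
    have "U $ Suc m \<in> S"
      unfolding S_def
    proof clarify
      fix v assume v: "v \<in> ?V"
      \<comment> \<open>k_h becomes invertible only in the quotient, so it is cancelled inside each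
        action.\<close>
      have Kinv: "act (uq_class t (gen (KGen (- h)) * (gen (KGen h) * U $ Suc m))) v = act (uq_class t (U $ Suc m)) v"
        if "uq_module t ?V act" for act
        using v by (simp only: act_mult[OF that] act_closed[OF that] act_KGen_inverse[OF that])
      have "gen (KGen (- h)) * (gen (KGen h) * U $ Suc m) \<in> S"
        by (intro mult KS KU)
      then show "act (uq_class t (U $ Suc m)) v = act' (uq_class t (U $ Suc m)) v"
        using v Kinv[OF act] Kinv[OF act'] by (simp add: S_def)
    qed
    then have "scal (1 / c) * (scal c * gen (HGen s i m)) \<in> S"
      using mult[OF scal[of "1 / c"]] by (simp add: U_def)
    moreover have "c \<noteq> 0"
      using q by (cases s) (simp_all add: c_def)
    ultimately show ?case
      by (simp add: scal_mult flip: mult.assoc)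
  qed
  have "p \<in> S" for p
  proof (induction p rule: free_algebra_induct)
    case (gen g)
    show ?case by (cases g) (auto intro: KS H basis X)
  qed (auto intro: scal add mult)
  then show ?thesis
    using v by (simp add: S_def)
qed

lemma module_with_action_eq:
  assumes act: "module_with_action t B xc ph kk act" and act': "module_with_action t B xc' ph' kk' act'"
    and q: "qdiff t \<noteq> 0"
    and x: "\<And>b s i r. b \<in> B \<Longrightarrow> current_coeff (xc s i b) r = current_coeff (xc' s i b) r"
    and ph: "\<And>b i. b \<in> B \<Longrightarrow> ph i b = ph' i b" and kk: "\<And>b h. b \<in> B \<Longrightarrow> kk h b = kk' h b"
    and v: "v \<in> vs.span (bvec ` B)"
  shows "act (uq_class t p) v = act' (uq_class t p) v"
  using act[unfolded module_with_action_def, THEN conjunct1]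
    act'[unfolded module_with_action_def, THEN conjunct1] q _ _ _ v
proof (rule uq_module_eq)
  fix b s i m assume b: "b \<in> B"
  obtain e where e: "expansion s (ph i b) e" "act (uq_class t (phi t s i m)) (bvec b) = vscale (e m) (bvec b)"
    using act b unfolding module_with_action_def by blast
  obtain e' where e': "expansion s (ph' i b) e'" "act' (uq_class t (phi t s i m)) (bvec b) = vscale (e' m) (bvec b)"
    using act' b unfolding module_with_action_def by blast
  show "act (uq_class t (phi t s i m)) (bvec b) = act' (uq_class t (phi t s i m)) (bvec b)"
    using e e' expansion_unique[of s "ph i b" e e'] ph[OF b] by simp
next
  fix b s i r assume b: "b \<in> B"
  show "act (uq_class t (xg s i r)) (bvec b) = act' (uq_class t (xg s i r)) (bvec b)"
    using act act' b x[OF b] unfolding module_with_action_def by simp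
next
  fix b h assume b: "b \<in> B"
  show "act (uq_class t (gen (KGen h))) (bvec b) = act' (uq_class t (gen (KGen h))) (bvec b)"
    using act act' b kk[OF b] unfolding module_with_action_def by simp
qed

text \<open>One action, built from \<open>ext_gen\<close>, realises any data with these structure
  constants, hence both modules.\<close>

lemma module_with_action_uq_action:
  assumes q: "qdiff t \<noteq> 0" and a: "a \<noteq> 0"
    and x: "\<And>T s i. T \<in> tableaux l \<Longrightarrow> current_regular (xc s i T)"
      "\<And>T s i r. T \<in> tableaux l \<Longrightarrow> current_coeff (xc s i T) r = reduced_coeff t a s i T r"
    and ph: "\<And>T i. T \<in> tableaux l \<Longrightarrow> ph i T = weight_fun t (occ i T) (spec t a i T)"
    and kk: "\<And>T h. T \<in> tableaux l \<Longrightarrow> kk h T = ext_k t h T"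
  shows "module_with_action t (tableaux l) xc ph kk (uq_action t (ext_gen t a))"
proof -
  note rel = rep_relations[OF q a]
  have span: "Poly_Mapping.single T c \<in> vs.span (bvec ` tableaux l)" if "T \<in> tableaux l" for T c
    unfolding vscale_bvec[symmetric] using that by (intro vs.span_scale vs.span_base) auto
  have "uq_module t (vs.span (bvec ` tableaux l)) (uq_action t (ext_gen t a))"
  proof (rule uq_module_uq_action[OF rel])
    fix g T assume T: "T \<in> tableaux l"
    then have "swp i T \<in> tableaux l" if "occ i T \<noteq> 0" for i
      using that sorted_wrt_swp[of T i] by (simp add: tableaux_def swp_def)
    then show "ext_gen t a g T \<in> vs.span (bvec ` tableaux l)"
    proof (cases g)
      case (XGen s i r)
      moreover have "- sg s \<noteq> 0" by (cases s) auto
      ultimately show ?thesis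
        using \<open>\<And>i. occ i T \<noteq> 0 \<Longrightarrow> swp i T \<in> tableaux l\<close>[of i] by (auto simp: ext_gen_def span vs.span_zero)
    qed (use T in \<open>auto simp: ext_gen_def span\<close>)
  qed
  moreover have "expansion s (ph i T) (phi_coeff t s (occ i T) (spec t a i T))" if "T \<in> tableaux l" for s i T
    using occ_cases[of i T] a by (auto simp: ph[OF that] intro!: expansion_weight_fun)
  moreover have "rep (ext_gen t a) (phi t s i m) (bvec T) =
      vscale (phi_coeff t s (occ i T) (spec t a i T) m) (bvec T)" for s i m T
    using rep_phi[OF q, of a s i m T 1] by (simp add: vscale_bvec) (simp add: bvec_def)
  moreover have "rep (ext_gen t a) (xg s i r) (bvec T) = reduced_coeff t a s i T r" for s i r T
    by (simp add: bvec_def rep_XGen reduced_coeff_def)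
  moreover have "rep (ext_gen t a) (gen (KGen h)) (bvec T) = vscale (ext_k t h T) (bvec T)" for h T
    by (simp add: bvec_def rep_KGen)
  moreover have "uq_action t (ext_gen t a) (uq_class t p) v = rep (ext_gen t a) p v" for p v
    by (rule uq_action_class) (rule rel)
  ultimately show ?thesis
    unfolding module_with_action_def using x kk by auto
qed

theorem theorem4p6:
  fixes t a :: complex and l :: nat
  assumes "\<forall>n::nat. n \<ge> 1 \<longrightarrow> exp t ^ n \<noteq> 1"
    and "l \<ge> 1"
    and "a \<noteq> 0"
  shows "(\<exists>act. is_fusion_module t l a act) \<and>
         (\<exists>act. is_extremal_module t l (a * qpow t (1 - of_nat l)) act) \<and>
         (\<forall>act act'. is_fusion_module t l a act \<longrightarrow>
            is_extremal_module t l (a * qpow t (1 - of_nat l)) act' \<longrightarrow>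
            uq_isomorphic t (fusion_space l) act (ext_space l) act')"
proof -
  \<comment> \<open>q^2 = 1 would make q - q^-1 vanish.\<close>
  have "exp t ^ 2 \<noteq> 1"
    using assms(1) by (metis one_le_numeral)
  then have q: "qdiff t \<noteq> 0"
    by (auto simp: qdiff_eq power2_eq_square field_simps)
  have fusion_phi: "fusion_phi t (fusion_params t l a) i T = weight_fun t (occ i T) (spec t a i T)"
    and fusion_k: "fusion_k t h T = ext_k t h T" if "T \<in> tableaux l" for i h T
    using that fusion_phi_eq[of T t a i] fusion_k_eq[of T t h]
    by (auto simp: tableaux_def strict_sorted_iff)
  have "is_fusion_module t l a (uq_action t (ext_gen t a))"
    unfolding is_fusion_module_def
    by (intro module_with_action_uq_action q assms(3) fusion_phi fusion_k
        fusion_current[OF _ assms(3) q])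
  moreover have "is_extremal_module t l (a * qpow t (1 - of_nat l)) (uq_action t (ext_gen t a))"
    unfolding is_extremal_module_def
    by (intro module_with_action_uq_action q assms(3) ext_phi_eq ext_current[OF _ assms(3)] refl)
  moreover have "uq_isomorphic t (fusion_space l) act (ext_space l) act'"
    if "is_fusion_module t l a act" "is_extremal_module t l (a * qpow t (1 - of_nat l)) act'" for act act'
  proof -
    \<comment> \<open>The data agree on the common basis, so the actions coincide and the identity
      is an isomorphism.\<close>
    have "act (uq_class t p) v = act' (uq_class t p) v" if "v \<in> fusion_space l" for p v
      using \<open>is_fusion_module t l a act\<close>[unfolded is_fusion_module_def]
        \<open>is_extremal_module t l _ act'\<close>[unfolded is_extremal_module_def] q
      by (rule module_with_action_eq)
        (use that assms(3) q in \<open>simp_all add: fusion_space_def fusion_current ext_current fusion_phi ext_phi_eq fusion_k\<close>)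
    then show ?thesis
      unfolding uq_isomorphic_def
      by (intro exI[of _ id]) (auto simp: carrier_Uq fusion_space_def ext_space_def)
  qed
  ultimately show ?thesis by blast
qed

end
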